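(* All the proofs of the value guarantees of the Main Algorithm (described in the context) use only the individual value functions. Therefore, when using the Main Algorithm, different agents may use different normalizations simultaneously and attain their more favorable guarantee. Explicitly: let $m,n,k\ge 1$ be integers, let $C$ be a multicake with $m$ islands and let $V_1,\dots,V_n$ be value-measures on $C$ with $V_i(C)>0$. Let $S\subseteq\{1,\dots,n\}$ be any set of agents. Let $V_i'$ be the absolute normalization of $V_i$ for $i\in S$, and the relative normalization of $V_i$ for $i\notin S$. Then the Main Algorithm, run on the padded multicake $C'$ with the value-measures $V_1',\dots,V_n'$, outputs a $k$-feasible allocation $(Z_1,\dots,Z_n)$ with $V_i'(Z_i)\ge k$ for all $i$, and hence $$V_i(Z_i)\ \ge\ \min\left(\frac1n,\frac{k}{m+n-1}\right)\cdot V_i(C)\quad\text{for all } i\in S,$$ $$V_i(Z_i)\ \ge\ \frac1n\cdot V_i(\mathrm{Best}^k_i(C))\quad\text{for all } i\in\{1,\dots,n\}\setminus S.$$ In particular, an agent for whom the first (absolute) guarantee is higher may use the absolute normalization, while an agent for whom the second (relative) guarantee is higher may use the relative normalization, and each of them attains his/her more favorable guarantee.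
   Context: A multicake $C$ with $m$ islands is the union of $m$ pairwise-disjoint intervals of unit length on the real line; these intervals are the islands. (After the leftmost part of an island has been allocated, its remainder again counts as an island.) For an island $B$ and $d\ge 0$, $B[d]$ is the sub-interval of length $d$ at the left-hand side of $B$. A value-measure is a function $V(Z)=\int_Z v(x)\,dx$ for (measurable) $Z\subseteq C$, with $v:C\to\mathbb{R}_{\ge 0}$ integrable. An allocation is a vector $(Z_1,\dots,Z_n)$ of pairwise-disjoint subsets of $C$, not necessarily covering $C$. It is $k$-feasible if each $Z_i$ is the union of at most $k$ intervals. $\mathrm{Best}^k_i(C)$ is the union of the $k$ islands of $C$ most valuable under $V_i$ (ties broken arbitrarily; all of $C$ if $m\le k$). Padding: $m'=\max(m,nk-n+1)$, and $C'$ is $C$ together with $m'-m$ dummy islands of value $0$ to all agents (dummy parts are discarded from final pieces). Absolute normalization: $V_i'(\cdot)=\frac{n+m'-1}{V_i(C)}V_i(\cdot)$, so that $V_i'(C')=n+m'-1$. Relative normalization: $V_i'$ has density $v_i'(x)=\frac{kn}{V_i(\mathrm{Best}^k_i(C))}v_i(x)$ for $x\in\mathrm{Best}^k_i(C)$ and $v_i'(x)=0$ otherwise. Thus at most $k$ islands have positive value and $V_i'(C')=kn$. Main Algorithm (recursive; here $C$, $m$, $n$, $V_j$ denote the current multicake, number of islands, number of agents and normalized value-measures). Step 1: if $n=1$, give the single agent the $k$ islands most valuable to him/her and terminate. Step 2: by the partial-allocation procedure below, find a nonempty set $L$ of agents and pieces $(Z_i)_{i\in L}$, and allocate $Z_i$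 to each $i\in L$. Step 3: let $\ell=|L|$; if more than $\ell(k-1)$ whole islands were removed in Step 2, add dummy islands of value $0$ so that exactly $m-\ell(k-1)$ islands remain. Step 4: recursively divide the remainder among the remaining agents (if any). Partial-allocation procedure. Call a set $A\subseteq C$ barren if $V_j(A)<k$ for all current agents $j$. Arbitrarily select $n$ pairwise-disjoint sets of $k-1$ islands each. Case 1: at least one of these sets, $A_0$, is barren. (i) Find a pair $(A^*,B^* )$ as follows. For every agent $j$ let $B_j$ be a set of islands outside $A_0$ most valuable to $j$, where the number of islands in $B_j$ is $k$ minus the number of islands in $A_0$. If $V_j(A_0\cup B_j)\ge k$ for some $j$, let $B^*$ be an arbitrary island of $B_j$ and let $A^*=(A_0\cup B_j)\setminus B^*$. Otherwise remove an arbitrary island from $A_0$ and repeat. (ii) For each agent $j$, let $d_j=\infty$ if $V_j(A^*\cup B^* )<k$; otherwise choose $d_j\ge 0$ with $V_j(A^*\cup B^*[d_j])=k$. Choose $i$ with minimal $d_i$ and return $L=\{i\}$, $Z_i=A^*\cup B^*[d_i]$. Case 2: none of the $n$ sets is barren. Form the bipartite graph between the $n$ agents and the $n$ sets, with an edge between an agent and a set if the agent values the set at least $k$. Find a nonempty envy-free matching in this graph (a matching in which no unmatched agent is adjacent to a matched set). Return the matched agents as $L$ and, for each of them, the matched set as $Z_i$. *)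

theory Defs
  imports "HOL-Analysis.Analysis"
begin

text \<open>A multicake is represented by the set of its islands; the region it covers is the union of
  that set. The predicate \<open>is_interval\<close> admits open, closed and half-open intervals, and
  an interval of finite positive measure is bounded.\<close>

definition unit_interval :: "real set \<Rightarrow> bool" where
  "unit_interval I \<longleftrightarrow> is_interval I \<and> measure lborel I = 1"

definition multicake :: "nat \<Rightarrow> real set set \<Rightarrow> bool" where
  "multicake m C \<longleftrightarrow> finite C \<and> card C = m \<and> disjoint C \<and> (\<forall>I\<in>C. unit_interval I)"

text \<open>The right end of the prefix is included, so that cutting off the full length of an island
  leaves nothing (rather than possibly a single point).\<close>

definition prefix :: "real set \<Rightarrow> real \<Rightarrow> real set" where
  "prefix B d = {x \<in> B. x \<le> Inf B + d}"

definition value_density :: "real set set \<Rightarrow> (real \<Rightarrow> real) \<Rightarrow> bool" where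
  "value_density C v \<longleftrightarrow> set_integrable lebesgue (\<Union>C) v \<and> (\<forall>x\<in>\<Union>C. 0 \<le> v x)"

definition val :: "(real \<Rightarrow> real) \<Rightarrow> real set \<Rightarrow> real" where
  "val v Z = (LINT x:Z|lebesgue. v x)"

text \<open>\<open>most_valuable W c M B\<close>: the set \<open>B\<close> is a possible choice (ties being broken arbitrarily)
  of the \<open>c\<close> islands in \<open>M\<close> that are most valuable under \<open>W\<close>.\<close>

definition most_valuable :: "(real set \<Rightarrow> real) \<Rightarrow> nat \<Rightarrow> real set set \<Rightarrow> real set set \<Rightarrow> bool" where
  "most_valuable W c M B \<longleftrightarrow>
     B \<subseteq> M \<and> card B = c \<and> (\<forall>I\<in>B. \<forall>J\<in>M - B. W J \<le> W I)"

definition is_best :: "nat \<Rightarrow> real set set \<Rightarrow> (real \<Rightarrow> real) \<Rightarrow> real set set \<Rightarrow> bool" where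
  "is_best k C v T \<longleftrightarrow> most_valuable (val v) (min k (card C)) C T"

definition k_feasible_allocation ::
  "nat \<Rightarrow> nat \<Rightarrow> real set set \<Rightarrow> (nat \<Rightarrow> real set) \<Rightarrow> bool" where
  "k_feasible_allocation n k C Z \<longleftrightarrow>
     (\<forall>i\<in>{1..n}. Z i \<subseteq> \<Union>C) \<and> disjoint_family_on Z {1..n} \<and>
     (\<forall>i\<in>{1..n}. \<exists>F. finite F \<and> card F \<le> k \<and> (\<forall>I\<in>F. is_interval I) \<and> Z i = \<Union>F)"

definition padded_size :: "nat \<Rightarrow> nat \<Rightarrow> nat \<Rightarrow> nat" where
  "padded_size n k m = max m (n * k - n + 1)"

definition padding :: "nat \<Rightarrow> nat \<Rightarrow> real set set \<Rightarrow> real set set \<Rightarrow> bool" where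
  "padding n k C C' \<longleftrightarrow> C \<subseteq> C' \<and> multicake (padded_size n k (card C)) C'"

text \<open>Original densities are meaningful on the original multicake only. Normalized densities are
  extended by 0, so that dummy islands have value 0.\<close>

definition abs_normalization ::
  "nat \<Rightarrow> nat \<Rightarrow> real set set \<Rightarrow> (real \<Rightarrow> real) \<Rightarrow> real \<Rightarrow> real" where
  "abs_normalization n k C v x =
     (if x \<in> \<Union>C
      then (real n + real (padded_size n k (card C)) - 1) / val v (\<Union>C) * v x
      else 0)"

text \<open>Here \<open>T\<close> is the chosen set of best islands.\<close>

definition rel_normalization ::
  "nat \<Rightarrow> nat \<Rightarrow> real set set \<Rightarrow> (real \<Rightarrow> real) \<Rightarrow> real \<Rightarrow> real" where
  "rel_normalization n k T v x =
     (if x \<in> \<Union>T then (real k * real n) / val v (\<Union>T) * v x else 0)"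

text \<open>The Main Algorithm is a nondeterministic transition system: every arbitrary choice is a
  transition of its own, so that an unlucky choice after which the algorithm cannot proceed would
  show up as a reachable state without successor. All states but the last carry
  the current islands \<open>M\<close>, the current agents \<open>N\<close> and the pieces \<open>Z\<close> allocated so far.\<close>

datatype state =
    Divide "real set set" "nat set" "nat \<Rightarrow> real set"
      \<comment> \<open>a (recursive) call\<close>
  | Selected "real set set" "nat set" "nat \<Rightarrow> real set" "nat \<Rightarrow> real set set"
      \<comment> \<open>\<open>A 0, \<dots>, A (card N - 1)\<close> have been selected\<close>
  | Search "real set set" "nat set" "nat \<Rightarrow> real set" "real set set"
      \<comment> \<open>loop head of Case 1 (i), with the current \<open>A\<^sub>0\<close>\<close>
  | Ranked "real set set" "nat set" "nat \<Rightarrow> real set" "real set set" "nat \<Rightarrow> real set set"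
      \<comment> \<open>loop body of Case 1 (i), with \<open>A\<^sub>0\<close> and the sets \<open>B\<^sub>j\<close>\<close>
  | Trim "real set set" "nat set" "nat \<Rightarrow> real set" "real set set" "real set"
      \<comment> \<open>Case 1 (ii), with the islands forming \<open>A\<^sup>*\<close> and the island \<open>B\<^sup>*\<close>\<close>
  | Allocate "real set set" "nat set" "nat \<Rightarrow> real set" "nat set" "nat \<Rightarrow> real set"
      \<comment> \<open>the agents \<open>L\<close> and their pieces \<open>P\<close> have been found\<close>
  | Finished "nat \<Rightarrow> real set"

definition barren :: "(nat \<Rightarrow> real set \<Rightarrow> real) \<Rightarrow> nat \<Rightarrow> nat set \<Rightarrow> real set \<Rightarrow> bool" where
  "barren V k N A \<longleftrightarrow> (\<forall>j\<in>N. V j A < real k)"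

text \<open>A matching of the agents in \<open>L\<close> with the sets indexed by \<open>f ` L\<close> in the bipartite graph
  between agents \<open>N\<close> and indices \<open>Q\<close> with edge relation \<open>E\<close>.\<close>

definition envy_free_matching ::
  "nat set \<Rightarrow> nat set \<Rightarrow> (nat \<Rightarrow> nat \<Rightarrow> bool) \<Rightarrow> nat set \<Rightarrow> (nat \<Rightarrow> nat) \<Rightarrow> bool" where
  "envy_free_matching N Q E L f \<longleftrightarrow>
     L \<subseteq> N \<and> inj_on f L \<and> f ` L \<subseteq> Q \<and> (\<forall>i\<in>L. E i (f i)) \<and>
     (\<forall>j\<in>N - L. \<forall>i\<in>L. \<not> E j (f i))"

definition cut_point :: "(real set \<Rightarrow> real) \<Rightarrow> nat \<Rightarrow> real set \<Rightarrow> real set \<Rightarrow> ereal \<Rightarrow> bool" where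
  "cut_point W k A B d \<longleftrightarrow>
     (if W (A \<union> B) < real k then d = \<infinity>
      else \<exists>r. d = ereal r \<and> 0 \<le> r \<and> r \<le> measure lborel B \<and> W (A \<union> prefix B r) = real k)"

definition remainder :: "real set set \<Rightarrow> real set \<Rightarrow> real set set" where
  "remainder M U = (\<lambda>I. I - U) ` M - {{}}"

definition whole_removed :: "real set set \<Rightarrow> real set \<Rightarrow> nat" where
  "whole_removed M U = card {I \<in> M. I \<subseteq> U}"

text \<open>Dummy islands avoid the current multicake and everything allocated before; the original
  multicake is always covered by these two parts.\<close>

definition dummies ::
  "(nat \<Rightarrow> real set \<Rightarrow> real) \<Rightarrow> real set set \<Rightarrow> nat set \<Rightarrow> (nat \<Rightarrow> real set) \<Rightarrow> real set set \<Rightarrow> bool" where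
  "dummies V M N Z D \<longleftrightarrow>
     finite D \<and> disjoint D \<and>
     (\<forall>I\<in>D. unit_interval I \<and> I \<inter> (\<Union>M \<union> (\<Union>i. Z i)) = {} \<and> (\<forall>j\<in>N. V j I = 0))"

inductive alg_step :: "(nat \<Rightarrow> real set \<Rightarrow> real) \<Rightarrow> nat \<Rightarrow> state \<Rightarrow> state \<Rightarrow> bool"
  for V :: "nat \<Rightarrow> real set \<Rightarrow> real" and k :: nat
where
  no_agent:
    "alg_step V k (Divide M {} Z) (Finished Z)"
| single_agent:
    "most_valuable (V i) k M B
     \<Longrightarrow> alg_step V k (Divide M {i} Z) (Finished (Z(i := \<Union>B)))"
| select_sets:
    "\<lbrakk>card N \<ge> 2;
      \<forall>t<card N. A t \<subseteq> M \<and> card (A t) = k - 1;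
      disjoint_family_on A {..<card N}\<rbrakk>
     \<Longrightarrow> alg_step V k (Divide M N Z) (Selected M N Z A)"
| case1:
    "\<lbrakk>t < card N; barren V k N (\<Union>(A t))\<rbrakk>
     \<Longrightarrow> alg_step V k (Selected M N Z A) (Search M N Z (A t))"
| case2:
    "\<lbrakk>\<forall>t<card N. \<not> barren V k N (\<Union>(A t));
      envy_free_matching N {..<card N} (\<lambda>i t. V i (\<Union>(A t)) \<ge> real k) L f;
      L \<noteq> {}\<rbrakk>
     \<Longrightarrow> alg_step V k (Selected M N Z A) (Allocate M N Z L (\<lambda>i. \<Union>(A (f i))))"
| rank:
    "\<forall>j\<in>N. most_valuable (V j) (k - card A0) (M - A0) (B j)
     \<Longrightarrow> alg_step V k (Search M N Z A0) (Ranked M N Z A0 B)"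
| pair_found:
    "\<lbrakk>j \<in> N; V j (\<Union>(A0 \<union> B j)) \<ge> real k; Bstar \<in> B j\<rbrakk>
     \<Longrightarrow> alg_step V k (Ranked M N Z A0 B) (Trim M N Z ((A0 \<union> B j) - {Bstar}) Bstar)"
| shrink:
    "\<lbrakk>\<forall>j\<in>N. V j (\<Union>(A0 \<union> B j)) < real k; I \<in> A0\<rbrakk>
     \<Longrightarrow> alg_step V k (Ranked M N Z A0 B) (Search M N Z (A0 - {I}))"
| trim:
    "\<lbrakk>\<forall>j\<in>N. cut_point (V j) k (\<Union>Astar) Bstar (d j);
      i \<in> N; \<forall>j\<in>N. d i \<le> d j; d i = ereal r\<rbrakk>
     \<Longrightarrow> alg_step V k (Trim M N Z Astar Bstar)
           (Allocate M N Z {i} (\<lambda>_. \<Union>Astar \<union> prefix Bstar r))"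
| recurse:
    "\<lbrakk>U = (\<Union>i\<in>L. P i); whole_removed M U \<le> card L * (k - 1)\<rbrakk>
     \<Longrightarrow> alg_step V k (Allocate M N Z L P)
           (Divide (remainder M U) (N - L) (override_on Z P L))"
| recurse_with_dummies:
    "\<lbrakk>U = (\<Union>i\<in>L. P i); whole_removed M U > card L * (k - 1);
      dummies V M N Z D;
      card (remainder M U \<union> D) = card M - card L * (k - 1)\<rbrakk>
     \<Longrightarrow> alg_step V k (Allocate M N Z L P)
           (Divide (remainder M U \<union> D) (N - L) (override_on Z P L))"

definition start :: "real set set \<Rightarrow> nat \<Rightarrow> state" where
  "start C n = Divide C {1..n} (\<lambda>_. {})"

definition always_outputs :: "(nat \<Rightarrow> real set \<Rightarrow> real) \<Rightarrow> nat \<Rightarrow> real set set \<Rightarrow> nat \<Rightarrow> bool" where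
  "always_outputs V k C n \<longleftrightarrow>
     (\<nexists>s. s 0 = start C n \<and> (\<forall>t::nat. alg_step V k (s t) (s (Suc t)))) \<and>
     (\<forall>s. (alg_step V k)\<^sup>*\<^sup>* (start C n) s \<and> (\<nexists>s'. alg_step V k s s') \<longrightarrow> (\<exists>Z. s = Finished Z))"

definition can_output ::
  "(nat \<Rightarrow> real set \<Rightarrow> real) \<Rightarrow> nat \<Rightarrow> real set set \<Rightarrow> nat \<Rightarrow> (nat \<Rightarrow> real set) \<Rightarrow> bool" where
  "can_output V k C n Z \<longleftrightarrow> (alg_step V k)\<^sup>*\<^sup>* (start C n) (Finished Z)"

definition discard_dummies :: "real set set \<Rightarrow> (nat \<Rightarrow> real set) \<Rightarrow> nat \<Rightarrow> real set" where
  "discard_dummies C Z i = Z i \<inter> \<Union>C"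

end

theory Submission
  imports Defs
begin

text \<open>Why every run succeeds: each agent who has not been served keeps a budget that is adapted to
  the number of agents and islands left. With the absolute normalization, the value of the cake is at
  least the number of agents plus the number of islands minus 1; with the relative normalization, it
  is at least \<open>k\<close> times the number of agents and lies on at most \<open>k\<close> islands. The
  predicate \<open>rich\<close> is the disjunction of the two, and no other part of the argument looks at the
  normalization, which is why different agents may use different ones.

  When \<open>l\<close> agents leave, they take pieces worth at most \<open>l * k\<close> to everybody who
  stays: in Case 2 because the matching is envy-free, in Case 1 because the cut with minimal
  \<open>d\<close> is at most the own cut of every other agent. The number of islands drops by exactly
  \<open>l * (k - 1)\<close>. Both budgets survive this exchange (\<open>sound_recurse\<close>): the absolute one
  because \<open>l + l * (k - 1) = l * k\<close>, the relative one because cutting and padding cannot create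
  new islands of positive value. Either budget also implies that the \<open>k\<close> best islands are worth
  at least \<open>k\<close> (\<open>best_islands_worth_k\<close>), by averaging in the absolute case and because
  they carry the entire value in the relative case. This serves the last agent, and it ensures that the
  search of Case 1 ends successfully at the latest when \<open>A\<^sub>0\<close> has become empty.

  The theorem concerns every run of a nondeterministic transition system. So the argument is
  organised as an invariant \<open>sound\<close> of states, which holds initially, is preserved by all steps
  (\<open>sound_step\<close>), excludes deadlocks (\<open>progress\<close>) and yields the guarantee in a
  final state; a lexicographic rank excludes infinite runs. Two existence results are needed for
  progress: an envy-free matching, which is obtained from Hall's theorem, and the cuts of Case 1,
  which are obtained from the continuity of value in the cut (\<open>ex_cut\<close>).\<close>

section \<open>Envy-free matchings\<close>

lemma card_Union_Diff:
  fixes G :: "'a \<Rightarrow> 'b set"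
  assumes "finite A" and "finite W" and "\<And>x. x \<in> A \<union> W \<Longrightarrow> finite (G x)"
  shows "card (\<Union>x\<in>W. G x - \<Union>(G ` A)) + card (\<Union>(G ` A)) = card (\<Union>(G ` (A \<union> W)))"
proof -
  have "card ((\<Union>x\<in>W. G x - \<Union>(G ` A)) \<union> \<Union>(G ` A))
    = card (\<Union>x\<in>W. G x - \<Union>(G ` A)) + card (\<Union>(G ` A))"
    using assms by (intro card_Un_disjoint) auto
  moreover have "(\<Union>x\<in>W. G x - \<Union>(G ` A)) \<union> \<Union>(G ` A) = \<Union>(G ` (A \<union> W))"
    by auto
  ultimately show ?thesis by simp
qed

text \<open>Hall's theorem, by the argument of Halmos and Vaughan: a proper subset meeting its bound with
  equality is matched on its own and its neighbours are removed; if there is none, every bound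
  has slack and an arbitrary edge can be removed.\<close>

lemma hall_marriage:
  fixes G :: "'a \<Rightarrow> 'b set"
  assumes "finite X" and "\<And>x. x \<in> X \<Longrightarrow> finite (G x)"
    and "\<And>W. W \<subseteq> X \<Longrightarrow> card W \<le> card (\<Union>(G ` W))"
  shows "\<exists>f. inj_on f X \<and> (\<forall>x\<in>X. f x \<in> G x)"
  using assms
proof (induction "card X" arbitrary: X G rule: less_induct)
  case less
  note IH = less(1) and fin = less(2) and finG = less(3) and hall = less(4)
  show ?case
  proof (cases "\<exists>W. W \<subset> X \<and> W \<noteq> {} \<and> card (\<Union>(G ` W)) = card W")
    case True
    then obtain W where W: "W \<subset> X" "W \<noteq> {}" "card (\<Union>(G ` W)) = card W" by blast
    have finW: "finite W" using W fin by (meson finite_subset psubset_imp_subset)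
    have "card W < card X" using W fin by (simp add: psubset_card_mono)
    then have "\<exists>f. inj_on f W \<and> (\<forall>x\<in>W. f x \<in> G x)"
      using W finW finG hall by (intro IH) auto
    then obtain f1 where f1: "inj_on f1 W" "\<forall>x\<in>W. f1 x \<in> G x" by blast
    define H where "H x = G x - \<Union>(G ` W)" for x
    have "card (X - W) < card X"
      using W fin by (intro psubset_card_mono) auto
    moreover have "card W' \<le> card (\<Union>(H ` W'))" if W': "W' \<subseteq> X - W" for W'
    proof -
      have finW': "finite W'" using W' fin finite_subset by auto
      have "card (\<Union>(H ` W')) + card (\<Union>(G ` W)) = card (\<Union>(G ` (W \<union> W')))"
        unfolding H_def using finW finW' W' W finG by (intro card_Union_Diff) auto
      moreover have "card (W \<union> W') \<le> card (\<Union>(G ` (W \<union> W')))"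
        using W W' by (intro hall) auto
      moreover have "card (W \<union> W') = card W + card W'"
        using finW finW' W' by (intro card_Un_disjoint) auto
      ultimately show ?thesis using W(3) by linarith
    qed
    ultimately have "\<exists>f. inj_on f (X - W) \<and> (\<forall>x\<in>X - W. f x \<in> H x)"
      using fin finG by (intro IH) (auto simp: H_def)
    then obtain f2 where f2: "inj_on f2 (X - W)" "\<forall>x\<in>X - W. f2 x \<in> H x" by blast
    have "f1 x \<noteq> f2 y" if "x \<in> W" "y \<in> X - W" for x y
      using f1(2) f2(2) that by (auto simp: H_def)
    then have "inj_on (\<lambda>x. if x \<in> W then f1 x else f2 x) X"
      using f1(1) f2(1) unfolding inj_on_def by (metis DiffI)
    moreover have "\<forall>x\<in>X. (if x \<in> W then f1 x else f2 x) \<in> G x"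
      using f1 f2 by (auto simp: H_def)
    ultimately show ?thesis by blast
  next
    case no_tight: False
    show ?thesis
    proof (cases "X = {}")
      case False
      then obtain x where x: "x \<in> X" by blast
      have "card {x} \<le> card (\<Union>(G ` {x}))" using x by (intro hall) auto
      then have "G x \<noteq> {}" by auto
      then obtain y where y: "y \<in> G x" by blast
      define H where "H z = G z - {y}" for z
      have "card (X - {x}) < card X" using card_Diff1_less[OF fin x] .
      moreover have "card W \<le> card (\<Union>(H ` W))" if W: "W \<subseteq> X - {x}" for W
      proof (cases "W = {}")
        case False
        have "W \<subset> X" using W x by auto
        then have "card W \<noteq> card (\<Union>(G ` W))" using no_tight False by metis
        moreover have "card W \<le> card (\<Union>(G ` W))" using \<open>W \<subset> X\<close> by (intro hall) auto
        moreover have "\<Union>(H ` W) = \<Union>(G ` W) - {y}" by (auto simp: H_def)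
        moreover have "card (\<Union>(G ` W)) - 1 \<le> card (\<Union>(G ` W) - {y})"
          by (simp add: card_Diff_singleton_if)
        ultimately show ?thesis by simp
      qed simp
      ultimately have "\<exists>f. inj_on f (X - {x}) \<and> (\<forall>z\<in>X - {x}. f z \<in> H z)"
        using fin finG by (intro IH) (auto simp: H_def)
      then obtain f where f: "inj_on f (X - {x})" "\<forall>z\<in>X - {x}. f z \<in> H z" by blast
      have "y \<notin> f ` (X - {x})" using f(2) by (auto simp: H_def)
      then have "inj_on (f(x := y)) (insert x (X - {x}))"
        using f(1) by (auto simp: inj_on_def)
      then have "inj_on (f(x := y)) X" using x by (simp add: insert_absorb)
      moreover have "\<forall>z\<in>X. (f(x := y)) z \<in> G z"
        using f y by (auto simp: H_def)
      ultimately show ?thesis by blast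
    qed simp
  qed
qed

text \<open>Let \<open>W0\<close> be a proper set of agents of maximal deficiency (number of agents minus number of
  neighbours). Outside \<open>W0\<close> and its neighbourhood, Hall's condition holds by maximality, and the sets
  used for the matching there are not adjacent to \<open>W0\<close>. Excluding the set of all agents costs
  nothing: its deficiency is at most 0, which is that of the empty set.\<close>

lemma ex_envy_free_matching:
  assumes "finite N" and "finite Q" and "card N \<le> card Q" and "N \<noteq> {}"
    and nbr: "\<And>t. t \<in> Q \<Longrightarrow> \<exists>i\<in>N. E i t"
  shows "\<exists>L f. envy_free_matching N Q E L f \<and> L \<noteq> {}"
proof -
  define G where "G i = {t \<in> Q. E i t}" for i
  define defi where "defi W = int (card W) - int (card (\<Union>(G ` W)))" for W
  have finG: "finite (G i)" for i using assms by (auto simp: G_def)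
  have "\<exists>W0\<in>{W. W \<subset> N}. \<forall>W\<in>{W. W \<subset> N}. defi W \<le> defi W0"
  proof -
    have fin: "finite {W. W \<subset> N}" 
      by (rule finite_subset[of _ "Pow N"]) (use assms(1) in auto)
    moreover have "{W. W \<subset> N} \<noteq> {}" using assms(4) by auto
    ultimately have "Max (defi ` {W. W \<subset> N}) \<in> defi ` {W. W \<subset> N}" by (intro Max_in) auto
    then obtain W0 where W0: "W0 \<in> {W. W \<subset> N}" "Max (defi ` {W. W \<subset> N}) = defi W0" by blast
    have "defi W \<le> defi W0" if "W \<in> {W. W \<subset> N}" for W
      using Max_ge[of "defi ` {W. W \<subset> N}" "defi W"] fin that W0(2) by simp
    with W0(1) show ?thesis by blast
  qed
  then obtain W0 where W0: "W0 \<subset> N" and max: "\<And>W. W \<subset> N \<Longrightarrow> defi W \<le> defi W0" by blast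
  have "\<Union>(G ` N) = Q" using nbr by (auto simp: G_def)
  then have "defi N \<le> defi {}" using assms(3) by (simp add: defi_def)
  then have max': "defi W \<le> defi W0" if "W \<subseteq> N" for W
  proof (cases "W = N")
    case True
    have "{} \<subset> N" using assms(4) by auto
    with max[of "{}"] \<open>defi N \<le> defi {}\<close> True show ?thesis by simp
  qed (use max[of W] that in auto)
  define L where "L = N - W0"
  define H where "H x = G x - \<Union>(G ` W0)" for x
  have fin0: "finite W0" "finite L" using assms(1) W0 by (auto simp: L_def intro: finite_subset)
  have "card W \<le> card (\<Union>(H ` W))" if W: "W \<subseteq> L" for W
  proof -
    have finW: "finite W" using W fin0 finite_subset by auto
    have "card (\<Union>(H ` W)) + card (\<Union>(G ` W0)) = card (\<Union>(G ` (W0 \<union> W)))"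
      unfolding H_def using finG finW fin0 by (intro card_Union_Diff) auto
    moreover have "defi (W0 \<union> W) \<le> defi W0"
      using W W0 by (intro max') (auto simp: L_def)
    moreover have "card (W0 \<union> W) = card W0 + card W"
      using finW fin0 W by (intro card_Un_disjoint) (auto simp: L_def)
    ultimately show ?thesis unfolding defi_def by linarith
  qed
  then have "\<exists>f. inj_on f L \<and> (\<forall>x\<in>L. f x \<in> H x)"
    using fin0 finG by (intro hall_marriage) (auto simp: H_def)
  then obtain f where f: "inj_on f L" "\<forall>x\<in>L. f x \<in> H x" by blast
  have "envy_free_matching N Q E L f"
    using f by (auto simp: envy_free_matching_def L_def H_def G_def)
  moreover have "L \<noteq> {}" using W0 by (auto simp: L_def)
  ultimately show ?thesis by blast
qed

section \<open>Selecting islands\<close>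

lemma ex_most_valuable:
  assumes "finite M" and "c \<le> card M"
  shows "\<exists>B. most_valuable W c M B"
  using assms(2)
proof (induction c)
  case 0
  show ?case by (rule exI[of _ "{}"]) (simp add: most_valuable_def)
next
  case (Suc c)
  then obtain B where B: "most_valuable W c M B" by auto
  then have finB: "finite B" using assms(1) by (auto simp: most_valuable_def intro: finite_subset)
  have "card (M - B) = card M - c"
    using B finB by (simp add: most_valuable_def card_Diff_subset)
  then have ne: "M - B \<noteq> {}" using Suc.prems by (metis card.empty diff_is_0_eq not_less_eq_eq)
  then have "Max (W ` (M - B)) \<in> W ` (M - B)" using assms(1) by (intro Max_in) auto
  then obtain I where I: "I \<in> M - B" "Max (W ` (M - B)) = W I" by blast
  have "W J \<le> W I" if "J \<in> M - B" for J
    using Max_ge[of "W ` (M - B)" "W J"] assms(1) that I by auto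
  then have "most_valuable W (Suc c) M (insert I B)"
    using B I finB by (auto simp: most_valuable_def)
  then show ?case by blast
qed

text \<open>Exchange argument: the elements of \<open>D\<close> outside \<open>B\<close> are injected into \<open>B\<close> outside
  \<open>D\<close>, which never lowers the value.\<close>

lemma most_valuable_sum_ge:
  assumes B: "most_valuable W c M B" and "finite M" and D: "D \<subseteq> M" "card D \<le> c"
    and nonneg: "\<And>I. I \<in> M \<Longrightarrow> 0 \<le> W I"
  shows "sum W D \<le> sum W B"
proof -
  have BM: "B \<subseteq> M" "card B = c" using B by (auto simp: most_valuable_def)
  have fin: "finite B" "finite D" using assms BM finite_subset by auto
  have "card D = card (D - B) + card (D \<inter> B)" "card B = card (B - D) + card (D \<inter> B)"
    using card_Int_Diff[of D B] card_Int_Diff[of B D] fin by (simp_all add: Int_commute)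
  then have "card (D - B) \<le> card (B - D)" using BM D by linarith
  then obtain g where g: "g ` (D - B) \<subseteq> B - D" "inj_on g (D - B)"
    using card_le_inj[of "D - B" "B - D"] fin by auto
  have "sum W (D - B) \<le> (\<Sum>I\<in>D - B. W (g I))"
  proof (intro sum_mono)
    fix I assume I: "I \<in> D - B"
    then have "g I \<in> B" "I \<in> M - B" using g(1) D(1) by auto
    then show "W I \<le> W (g I)" using B by (auto simp: most_valuable_def)
  qed
  also have "\<dots> = sum W (g ` (D - B))" using g by (simp add: sum.reindex)
  also have "\<dots> \<le> sum W (B - D)"
    using g fin BM nonneg by (intro sum_mono2) auto
  finally have "sum W (D - B) \<le> sum W (B - D)" .
  moreover have "sum W D = sum W (D \<inter> B) + sum W (D - B)"
    using fin by (intro sum.Int_Diff)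
  moreover have "sum W B = sum W (D \<inter> B) + sum W (B - D)"
    using sum.Int_Diff[of B W D] fin by (simp add: Int_commute)
  ultimately show ?thesis by linarith
qed

text \<open>Summing \<open>W J \<le> W I\<close> over all chosen \<open>I\<close> and all other \<open>J\<close> shows that the chosen
  islands are worth at least the average.\<close>

lemma most_valuable_average:
  assumes B: "most_valuable W c M B" and "finite M"
  shows "real c * sum W M \<le> real (card M) * sum W B"
proof -
  have BM: "B \<subseteq> M" "card B = c" using B by (auto simp: most_valuable_def)
  have fin: "finite B" using assms BM finite_subset by auto
  have "real c * sum W (M - B) = (\<Sum>I\<in>B. \<Sum>J\<in>M - B. W J)" using BM by simp
  also have "\<dots> \<le> (\<Sum>I\<in>B. \<Sum>J\<in>M - B. W I)"
    using B by (intro sum_mono) (auto simp: most_valuable_def)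
  also have "\<dots> = real (card (M - B)) * sum W B" by (simp add: sum_distrib_left)
  also have "real (card (M - B)) = real (card M) - real c"
    using BM fin card_mono[OF assms(2) BM(1)] by (simp add: card_Diff_subset of_nat_diff)
  finally have "real c * sum W (M - B) \<le> (real (card M) - real c) * sum W B" .
  moreover have "sum W M = sum W B + sum W (M - B)"
    using BM assms(2) by (metis add.commute sum.subset_diff)
  ultimately show ?thesis by (simp add: algebra_simps)
qed

lemma ex_disjoint_selection:
  assumes "finite M" and "r * c \<le> card M"
  shows "\<exists>A. (\<forall>t<r. A t \<subseteq> M \<and> card (A t) = c) \<and> disjoint_family_on A {..<r}"
  using assms
proof (induction r arbitrary: M)
  case (Suc r)
  then have "c \<le> card M" by simp
  then obtain S where S: "S \<subseteq> M" "card S = c" "finite S"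
    by (rule obtain_subset_with_card_n)
  have "r * c \<le> card (M - S)" using Suc.prems S by (simp add: card_Diff_subset)
  then obtain A where A: "\<forall>t<r. A t \<subseteq> M - S \<and> card (A t) = c" "disjoint_family_on A {..<r}"
    using Suc.IH[of "M - S"] Suc.prems by auto
  have "\<forall>t<Suc r. (A(r := S)) t \<subseteq> M \<and> card ((A(r := S)) t) = c"
    using A S by (auto simp: less_Suc_eq)
  moreover have "disjoint_family_on (A(r := S)) {..<Suc r}"
  proof -
    have "A t \<inter> S = {}" if "t < r" for t using A that by blast
    then have "S \<inter> \<Union>(A ` {..<r}) = {}" by blast
    then show ?thesis
      using A(2) by (simp add: lessThan_Suc disjoint_family_on_insert) (simp add: disjoint_family_on_def)
  qed
  ultimately show ?case by blast
qed (auto simp: disjoint_family_on_def)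

section \<open>Intervals and remainders\<close>

text \<open>An interval differs from the open interval between its infimum and supremum by at most two points.\<close>

lemma bounded_interval_borel:
  fixes B :: "real set"
  assumes "is_interval B" and "bounded B"
  shows "B \<in> sets borel"
proof (cases "B = {}")
  case False
  have bd: "bdd_below B" "bdd_above B"
    using assms(2) by (simp_all add: bounded_imp_bdd_below bounded_imp_bdd_above)
  have "y \<in> B" if y: "Inf B < y" "y < Sup B" for y
  proof -
    obtain x z where "x \<in> B" "x < y" "z \<in> B" "y < z"
      using y False bd by (metis cInf_less_iff less_cSup_iff)
    then show "y \<in> B" using assms(1) unfolding is_interval_1 by (meson less_imp_le)
  qed
  moreover have "B \<subseteq> {Inf B..Sup B}" using bd by (auto intro: cInf_lower cSup_upper)
  ultimately have "B = {Inf B<..<Sup B} \<union> (B \<inter> {Inf B, Sup B})" by force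
  moreover have "B \<inter> {Inf B, Sup B} \<in> sets borel" by (intro finite_imp_closed borel_closed) auto
  ultimately show ?thesis by (metis borel_open open_greaterThanLessThan sets.Un)
qed simp

lemma bounded_interval_lebesgue:
  fixes B :: "real set"
  assumes "is_interval B" and "bounded B"
  shows "B \<in> sets lebesgue"
  using bounded_interval_borel[OF assms] by simp

lemma interval_length_le_measure:
  fixes B :: "real set"
  assumes "is_interval B" and "B \<in> fmeasurable lborel" and "x \<in> B" and "y \<in> B"
  shows "y - x \<le> measure lborel B"
proof (cases "x \<le> y")
  case True
  have "{x..y} \<subseteq> B" using assms(1,3,4) unfolding is_interval_1 by (meson atLeastAtMost_iff subsetI)
  then have "measure lborel {x..y} \<le> measure lborel B"
    using assms(2) by (intro measure_mono_fmeasurable) auto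
  then show ?thesis using True by simp
next
  case False
  then show ?thesis using measure_nonneg[of lborel B] by linarith
qed

lemma unit_interval_bounded:
  assumes "unit_interval I"
  shows "bounded I" and "I \<noteq> {}"
proof -
  have m: "measure lborel I = 1" "is_interval I" using assms by (auto simp: unit_interval_def)
  show "I \<noteq> {}" using m by auto
  then obtain x where x: "x \<in> I" by blast
  have "I \<in> fmeasurable lborel"
    using m by (metis fmeasurableI measure_eq_0_null_sets measure_def measure_notin_sets
      enn2real_top zero_neq_one infinity_ennreal_def less_top)
  then have "\<bar>y - x\<bar> \<le> 1" if "y \<in> I" for y
    using interval_length_le_measure[OF m(2), of x y] interval_length_le_measure[OF m(2), of y x]
      m(1) x that by auto
  then have "I \<subseteq> {x - 1..x + 1}" by force
  then show "bounded I" by (rule bounded_subset[rotated]) simp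
qed

text \<open>The measure of an interval is at least the distance of any two of its points. So a cut at full
  length leaves nothing, whatever the type of the interval; this makes the last cut point available
  when the intermediate value theorem is applied.\<close>

lemma prefix_full:
  assumes "is_interval B" and "bounded B"
  shows "prefix B (measure lborel B) = B"
proof -
  have fm: "B \<in> fmeasurable lborel"
    using bounded_interval_borel[OF assms] emeasure_bounded_finite[OF assms(2)] by (auto intro: fmeasurableI)
  have "x \<le> Inf B + measure lborel B" if x: "x \<in> B" for x
  proof -
    have "x - measure lborel B \<le> y" if "y \<in> B" for y
      using interval_length_le_measure[OF assms(1) fm that x] by linarith
    then have "x - measure lborel B \<le> Inf B" using x by (intro cInf_greatest) auto
    then show ?thesis by linarith
  qed
  then show ?thesis by (auto simp: prefix_def)
qed

lemma is_interval_Int_ray: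
  fixes B :: "real set"
  assumes "is_interval B"
  shows "is_interval {x \<in> B. x \<le> c}" and "is_interval {x \<in> B. c < x}"
  using assms unfolding is_interval_1 by (blast intro: order_trans less_le_trans)+

text \<open>Removing a set acts injectively on the islands that it does not swallow, because they are disjoint.
  Hence no island is lost except those that \<open>whole_removed\<close> counts.\<close>

lemma card_remainder:
  assumes "finite M" and "disjoint M"
  shows "card (remainder M U) + whole_removed M U = card M"
proof -
  have "remainder M U = (\<lambda>I. I - U) ` {I \<in> M. \<not> I \<subseteq> U}"
    by (auto simp: remainder_def)
  moreover have "inj_on (\<lambda>I. I - U) {I \<in> M. \<not> I \<subseteq> U}"
  proof (rule inj_onI)
    fix I J assume I: "I \<in> {I \<in> M. \<not> I \<subseteq> U}" and J: "J \<in> {I \<in> M. \<not> I \<subseteq> U}" and eq: "I - U = J - U"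
    then obtain x where "x \<in> I" "x \<in> J" by blast
    then show "I = J" using assms(2) I J by (auto simp: disjoint_def)
  qed
  ultimately have "card (remainder M U) = card {I \<in> M. \<not> I \<subseteq> U}" by (simp add: card_image)
  moreover have "card {I \<in> M. \<not> I \<subseteq> U} + card {I \<in> M. I \<subseteq> U} = card M"
    using assms(1) by (subst card_Un_disjoint[symmetric]) (auto intro: arg_cong[of _ _ card])
  ultimately show ?thesis by (simp add: whole_removed_def)
qed

lemma Union_remainder: "\<Union>(remainder M U) = \<Union>M - U"
  by (auto simp: remainder_def)

lemma disjoint_remainder: "disjoint M \<Longrightarrow> disjoint (remainder M U)"
  unfolding remainder_def disjoint_def by blast

lemma finite_remainder: "finite M \<Longrightarrow> finite (remainder M U)"
  by (simp add: remainder_def)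

section \<open>Value of a set under a nonnegative density\<close>

locale density =
  fixes w :: "real \<Rightarrow> real"
  assumes integrable: "integrable lebesgue w"
    and nonneg: "\<And>x. 0 \<le> w x"
begin

lemma set_integrable: "A \<in> sets lebesgue \<Longrightarrow> set_integrable lebesgue A w"
  unfolding set_integrable_def using integrable by (rule integrable_mult_indicator[rotated])

lemma val_nonneg: "0 \<le> val w A"
  unfolding val_def set_lebesgue_integral_def
  by (intro integral_nonneg_AE) (simp add: nonneg)

lemma val_mono:
  assumes "A \<in> sets lebesgue" "B \<in> sets lebesgue" "A \<subseteq> B"
  shows "val w A \<le> val w B"
  unfolding val_def set_lebesgue_integral_def
  using set_integrable[OF assms(1)] set_integrable[OF assms(2)] assms(3) nonneg
  by (intro integral_mono) (auto simp: set_integrable_def indicator_def)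

lemma val_Un:
  assumes "A \<in> sets lebesgue" "B \<in> sets lebesgue" "A \<inter> B = {}"
  shows "val w (A \<union> B) = val w A + val w B"
  unfolding val_def by (intro set_integral_Un set_integrable assms)

lemma val_Diff:
  assumes "A \<in> sets lebesgue" "B \<in> sets lebesgue" "B \<subseteq> A"
  shows "val w (A - B) = val w A - val w B"
proof -
  have "val w ((A - B) \<union> B) = val w (A - B) + val w B" using assms by (intro val_Un) auto
  moreover have "(A - B) \<union> B = A" using assms(3) by blast
  ultimately show ?thesis by simp
qed

lemma val_UN:
  assumes "finite L" "disjoint_family_on P L" "\<And>i. i \<in> L \<Longrightarrow> P i \<in> sets lebesgue"
  shows "val w (\<Union>i\<in>L. P i) = (\<Sum>i\<in>L. val w (P i))"
  unfolding val_def using assms by (intro set_integral_finite_Union set_integrable) auto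

lemma val_Union:
  assumes "finite F" "disjoint F" "F \<subseteq> sets lebesgue"
  shows "val w (\<Union>F) = sum (val w) F"
  using val_UN[of F "\<lambda>I. I"] assms by (simp add: disjoint_family_on_def disjoint_def subset_iff)

text \<open>Because value is given by a density, it grows continuously with the cut, so the
  intermediate value theorem provides the cut.\<close>

lemma ex_cut:
  assumes A: "A \<in> sets lebesgue" and B: "is_interval B" "bounded B" and disj: "A \<inter> B = {}"
    and "val w A \<le> c" and "c \<le> val w (A \<union> B)"
  shows "\<exists>r. 0 \<le> r \<and> r \<le> measure lborel B \<and> val w (A \<union> prefix B r) = c"
proof -
  let ?g = "\<lambda>x. indicator B x *\<^sub>R w x" and ?a = "Inf B" and ?l = "measure lborel B"
  have meas: "prefix B r \<in> sets lebesgue" for r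
    unfolding prefix_def using is_interval_Int_ray(1)[OF B(1)] B(2)
    by (intro bounded_interval_lebesgue) (auto intro: bounded_subset)
  have g: "set_integrable lebesgue S ?g" if "S \<in> sets lebesgue" for S
    using set_integrable[OF bounded_interval_lebesgue[OF B]] that
    unfolding set_integrable_def by (rule integrable_mult_indicator[rotated])
  have "B \<subseteq> {?a..}" using bounded_imp_bdd_below[OF B(2)] by (auto intro: cInf_lower)
  then have "indicator (prefix B r) x *\<^sub>R w x = indicator {?a..?a + r} x *\<^sub>R ?g x" for r x
    by (auto simp: prefix_def indicator_def)
  then have "val w (prefix B r) = (LINT x:{?a..?a + r}|lebesgue. ?g x)" for r
    unfolding val_def set_lebesgue_integral_def by (intro Bochner_Integration.integral_cong) auto
  then have F: "val w (prefix B r) = integral {?a..?a + r} ?g" for r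
    using set_lebesgue_integral_eq_integral(2)[OF g] by simp
  have "continuous_on {?a..?a + ?l} (\<lambda>x. integral {?a..x} ?g)"
    using set_lebesgue_integral_eq_integral(1)[OF g] by (intro indefinite_integral_continuous_1) auto
  then have "continuous_on {0..?l} ((\<lambda>x. integral {?a..x} ?g) \<circ> (\<lambda>r. ?a + r))"
    by (intro continuous_on_compose continuous_intros) (simp add: add.commute)
  then have cont: "continuous_on {0..?l} (\<lambda>r. val w (prefix B r))"
    by (simp add: F o_def)
  have Un: "val w (A \<union> prefix B r) = val w A + val w (prefix B r)" for r
    using disj by (intro val_Un A meas) (auto simp: prefix_def)
  have "val w (prefix B 0) \<le> c - val w A"
    using assms(5) by (simp add: F)
  moreover have "c - val w A \<le> val w (prefix B ?l)"
    using assms(6) Un[of ?l] by (simp add: prefix_full[OF B])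
  ultimately have "\<exists>r\<ge>0. r \<le> ?l \<and> val w (prefix B r) = c - val w A"
    using cont by (intro IVT') auto
  then show ?thesis using Un by auto
qed

end

section \<open>The invariant of the algorithm\<close>

text \<open>The densities are the normalized ones, and \<open>X\<close> is the region of the original multicake.\<close>

locale division =
  fixes w :: "nat \<Rightarrow> real \<Rightarrow> real" and k n :: nat and X :: "real set"
  assumes density: "\<And>i. i \<in> {1..n} \<Longrightarrow> density (w i)"
    and k_pos: "1 \<le> k"
    and bounded_X: "bounded X"
    and zero_outside: "\<And>i x. i \<in> {1..n} \<Longrightarrow> x \<notin> X \<Longrightarrow> w i x = 0"
begin

abbreviation V :: "nat \<Rightarrow> real set \<Rightarrow> real" where
  "V i \<equiv> val (w i)"

text \<open>The pieces are intersected with \<open>X\<close> at the very end, when dummy parts are discarded; therefore the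
  invariant records that this intersection leaves an interval. Unit length is
  not preserved, since the remainder of an island may be arbitrarily short.\<close>

definition island :: "real set \<Rightarrow> bool" where
  "island I \<longleftrightarrow> is_interval I \<and> bounded I \<and> I \<noteq> {} \<and> is_interval (I \<inter> X)"

definition islands :: "real set set \<Rightarrow> bool" where
  "islands M \<longleftrightarrow> finite M \<and> disjoint M \<and> (\<forall>I\<in>M. island I)"

definition feasible :: "real set \<Rightarrow> bool" where
  "feasible Z \<longleftrightarrow> (\<exists>F. finite F \<and> card F \<le> k \<and> (\<forall>I\<in>F. is_interval (I \<inter> X)) \<and> Z = \<Union>F)"

text \<open>The first alternative is the budget of the absolute normalization, the second that of the relative
  one.\<close>

definition rich :: "real set set \<Rightarrow> nat set \<Rightarrow> nat \<Rightarrow> bool" where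
  "rich M N j \<longleftrightarrow>
     real (card N) + real (card M) - 1 \<le> V j (\<Union>M) \<or>
     card {I \<in> M. 0 < V j I} \<le> k \<and> real k * real (card N) \<le> V j (\<Union>M)"

definition served :: "nat set \<Rightarrow> (nat \<Rightarrow> real set) \<Rightarrow> bool" where
  "served N Z \<longleftrightarrow> disjoint_family Z \<and> (\<forall>i\<in>N. real k \<le> V i (Z i) \<and> feasible (Z i))"

text \<open>The islands and the allocated pieces together always cover \<open>X\<close>. So dummy islands, which avoid both,
  do not meet \<open>X\<close>, and a piece made of them stays feasible when dummy parts are discarded.\<close>

definition call :: "real set set \<Rightarrow> nat set \<Rightarrow> (nat \<Rightarrow> real set) \<Rightarrow> bool" where
  "call M N Z \<longleftrightarrow>
     islands M \<and> N \<subseteq> {1..n} \<and> card N * (k - 1) + 1 \<le> card M \<and> (\<forall>j\<in>N. rich M N j) \<and>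
     served ({1..n} - N) Z \<and> (\<forall>i. i \<notin> {1..n} - N \<longrightarrow> Z i = {}) \<and>
     \<Union>M \<inter> (\<Union>i. Z i) = {} \<and> X \<subseteq> \<Union>M \<union> (\<Union>i. Z i) \<and> bounded (\<Union>i. Z i)"

text \<open>The key to Case 1: all extensions of \<open>A0\<close> to \<open>k - 1\<close> islands are barren. The set \<open>A\<^sup>*\<close> that is
  returned is such an extension, so nobody reaches the value \<open>k\<close> before the final island is cut.\<close>

definition search :: "real set set \<Rightarrow> nat set \<Rightarrow> real set set \<Rightarrow> bool" where
  "search M N A0 \<longleftrightarrow> A0 \<subseteq> M \<and> card A0 < k \<and>
     (\<forall>i\<in>N. \<forall>D. D \<subseteq> M - A0 \<and> card A0 + card D = k - 1 \<longrightarrow> V i (\<Union>(A0 \<union> D)) < real k)"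

text \<open>The last two conjuncts say what the remaining agents lose in value and that enough islands
  disappear; the latter is a lower bound because dummy islands can repair a surplus only.\<close>

definition allocation :: "real set set \<Rightarrow> nat set \<Rightarrow> nat set \<Rightarrow> (nat \<Rightarrow> real set) \<Rightarrow> bool" where
  "allocation M N L P \<longleftrightarrow> L \<subseteq> N \<and> L \<noteq> {} \<and> disjoint_family_on P L \<and>
     (\<forall>i\<in>L. real k \<le> V i (P i) \<and> feasible (P i) \<and> P i \<subseteq> \<Union>M \<and> P i \<in> sets lebesgue) \<and>
     (\<forall>I\<in>M. I \<subseteq> (\<Union>i\<in>L. P i) \<or> island (I - (\<Union>i\<in>L. P i))) \<and>
     (\<forall>j\<in>N - L. V j (\<Union>i\<in>L. P i) \<le> real (card L) * real k) \<and>
     card L * (k - 1) \<le> whole_removed M (\<Union>i\<in>L. P i)"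

fun sound :: "state \<Rightarrow> bool" where
  "sound (Divide M N Z) \<longleftrightarrow> call M N Z"
| "sound (Selected M N Z A) \<longleftrightarrow> call M N Z \<and> 2 \<le> card N \<and>
     (\<forall>t<card N. A t \<subseteq> M \<and> card (A t) = k - 1) \<and> disjoint_family_on A {..<card N}"
| "sound (Search M N Z A0) \<longleftrightarrow> call M N Z \<and> 2 \<le> card N \<and> search M N A0"
| "sound (Ranked M N Z A0 B) \<longleftrightarrow> call M N Z \<and> 2 \<le> card N \<and> search M N A0 \<and>
     (\<forall>j\<in>N. most_valuable (V j) (k - card A0) (M - A0) (B j))"
| "sound (Trim M N Z A b) \<longleftrightarrow> call M N Z \<and> A \<subseteq> M \<and> card A = k - 1 \<and> b \<in> M - A \<and>
     (\<forall>j\<in>N. V j (\<Union>A) < real k) \<and> (\<exists>j\<in>N. real k \<le> V j (\<Union>A \<union> b))"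
| "sound (Allocate M N Z L P) \<longleftrightarrow> call M N Z \<and> allocation M N L P"
| "sound (Finished Z) \<longleftrightarrow> served {1..n} Z"

subsection \<open>Values of sets of islands\<close>

lemma island_lebesgue: "island I \<Longrightarrow> I \<in> sets lebesgue"
  by (simp add: island_def bounded_interval_lebesgue)

lemma islands_subset: "islands M \<Longrightarrow> F \<subseteq> M \<Longrightarrow> islands F"
  unfolding islands_def by (meson finite_subset pairwise_subset subsetD)

lemma islands_lebesgue: "islands M \<Longrightarrow> F \<subseteq> M \<Longrightarrow> \<Union>F \<in> sets lebesgue"
  using islands_subset[of M F] island_lebesgue by (intro sets.finite_Union) (auto simp: islands_def)

lemma val_islands:
  assumes "islands M" and "F \<subseteq> M" and "j \<in> {1..n}"
  shows "V j (\<Union>F) = sum (V j) F"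
  using islands_subset[OF assms(1,2)] island_lebesgue
  by (intro density.val_Union density assms) (auto simp: islands_def)

lemma islands_disjoint_Union:
  assumes "islands M" and "F \<subseteq> M" and "G \<subseteq> M" and "F \<inter> G = {}"
  shows "\<Union>F \<inter> \<Union>G = {}"
proof -
  have "I \<inter> J = {}" if "I \<in> F" "J \<in> G" for I J
  proof (rule disjointD)
    show "disjoint M" using assms(1) by (simp add: islands_def)
  qed (use assms that in auto)
  then show ?thesis by blast
qed

lemma feasible_Union:
  assumes "islands M" and "F \<subseteq> M" and "card F \<le> k"
  shows "feasible (\<Union>F)"
  using islands_subset[OF assms(1,2)] assms(3)
  unfolding feasible_def islands_def island_def by blast

text \<open>In the absolute case the average value of an island is at least 1, as the number of islands is at
  most the total value. In the relative case the best \<open>k\<close> islands are worth at least as much as the at most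
  \<open>k\<close> islands of positive value, which carry the total value of at least \<open>k\<close>.\<close>

lemma best_islands_worth_k:
  assumes "call M N Z" and "j \<in> N" and B: "most_valuable (V j) k M B"
  shows "real k \<le> V j (\<Union>B)"
proof -
  have M: "islands M" "finite M" and j: "j \<in> {1..n}" and rich: "rich M N j" and finN: "finite N"
    using assms by (auto simp: call_def islands_def intro: finite_subset)
  have cN: "1 \<le> card N" using finN assms(2) by (metis One_nat_def Suc_leI card_gt_0_iff empty_iff)
  have BM: "B \<subseteq> M" "card B = k" using B by (auto simp: most_valuable_def)
  have VM: "V j (\<Union>M) = sum (V j) M" and VB: "V j (\<Union>B) = sum (V j) B"
    using val_islands[OF M(1) _ j] BM by auto
  have nn: "0 \<le> V j I" for I using density.val_nonneg[OF density[OF j]] .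
  from rich show ?thesis unfolding rich_def
  proof
    assume "real (card N) + real (card M) - 1 \<le> V j (\<Union>M)"
    then have "real (card M) \<le> sum (V j) M" using cN VM by simp
    then have "real k * real (card M) \<le> real k * sum (V j) M" by (intro mult_left_mono) auto
    also have "\<dots> \<le> real (card M) * sum (V j) B"
      using most_valuable_average[OF B M(2)] .
    finally have "real (card M) * real k \<le> real (card M) * sum (V j) B" by (simp add: mult.commute)
    moreover have "0 < card M" using assms(1) by (auto simp: call_def)
    ultimately show ?thesis using VB by simp
  next
    assume *: "card {I \<in> M. 0 < V j I} \<le> k \<and> real k * real (card N) \<le> V j (\<Union>M)"
    have "real k * 1 \<le> real k * real (card N)" using cN by (intro mult_left_mono) auto
    also have "\<dots> \<le> sum (V j) M" using * VM by simp
    also have "\<dots> = sum (V j) {I \<in> M. 0 < V j I}"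
      using M(2) nn by (intro sum.mono_neutral_right) (auto simp: less_le)
    also have "\<dots> \<le> sum (V j) B"
      using * nn M(2) by (intro most_valuable_sum_ge[OF B]) auto
    finally show ?thesis using VB by simp
  qed
qed

subsection \<open>Preservation of the invariant\<close>

lemma sound_finish_single:
  assumes "call M {i} Z" and B: "most_valuable (V i) k M B"
  shows "served {1..n} (Z(i := \<Union>B))"
proof -
  have BM: "B \<subseteq> M" "card B = k" using B by (auto simp: most_valuable_def)
  have *: "islands M" "served ({1..n} - {i}) Z" "\<Union>M \<inter> (\<Union>i. Z i) = {}"
    using assms(1) by (auto simp: call_def)
  have "\<Union>B \<inter> Z j = {}" for j using *(3) BM(1) by blast
  then have "disjoint_family (Z(i := \<Union>B))"
    using *(2) by (auto simp: served_def disjoint_family_on_def)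
  moreover have "feasible (\<Union>B)" using feasible_Union[OF *(1) BM(1)] BM(2) by simp
  moreover have "real k \<le> V i (\<Union>B)" using best_islands_worth_k[OF assms(1) _ B] by simp
  ultimately show ?thesis using *(2) by (auto simp: served_def)
qed

text \<open>A set of \<open>k - 1\<close> islands has no extension to \<open>k - 1\<close> islands but itself, and it is barren.\<close>

lemma sound_case1:
  assumes "sound (Selected M N Z A)" and "t < card N" and "barren V k N (\<Union>(A t))"
  shows "search M N (A t)"
proof -
  have A: "A t \<subseteq> M" "card (A t) = k - 1" and fin: "finite M"
    using assms(1,2) by (auto simp: call_def islands_def)
  have "V i (\<Union>(A t \<union> D)) < real k" if "i \<in> N" "D \<subseteq> M - A t" "card (A t) + card D = k - 1" for i D
  proof -
    have "finite D" using that fin by (meson Diff_subset finite_subset order_trans)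
    then have "D = {}" using that A by simp
    then show ?thesis using assms(3) that by (simp add: barren_def)
  qed
  then show ?thesis using A k_pos by (auto simp: search_def)
qed

lemma sound_case2:
  assumes snd: "sound (Selected M N Z A)"
    and efm: "envy_free_matching N {..<card N} (\<lambda>i t. V i (\<Union>(A t)) \<ge> real k) L f"
    and "L \<noteq> {}"
  shows "allocation M N L (\<lambda>i. \<Union>(A (f i)))"
proof -
  have M: "islands M" "finite M" and N: "N \<subseteq> {1..n}" and dA: "disjoint_family_on A {..<card N}"
    using snd by (auto simp: call_def islands_def)
  have f: "L \<subseteq> N" "inj_on f L" "\<forall>i\<in>L. f i < card N" "\<forall>i\<in>L. V i (\<Union>(A (f i))) \<ge> real k"
     "\<forall>j\<in>N - L. \<forall>i\<in>L. V j (\<Union>(A (f i))) < real k"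
    using efm by (simp_all add: envy_free_matching_def image_subset_iff not_le)
  have finL: "finite L" by (rule finite_subset[OF order_trans[OF f(1) N]]) simp
  have A: "A (f i) \<subseteq> M" "card (A (f i)) = k - 1" if "i \<in> L" for i
    using snd f(3) that by auto
  have dAf: "A (f i) \<inter> A (f i') = {}" if "i \<in> L" "i' \<in> L" "i \<noteq> i'" for i i'
  proof -
    have "f i \<noteq> f i'" using f(2) that by (auto dest: inj_onD)
    then show ?thesis using dA f(3) that unfolding disjoint_family_on_def by blast
  qed
  let ?P = "\<lambda>i. \<Union>(A (f i))"
  let ?U = "\<Union>i\<in>L. ?P i"
  have dP: "disjoint_family_on ?P L"
    unfolding disjoint_family_on_def
    by (intro ballI impI islands_disjoint_Union[OF M(1)] A(1) dAf)
  have leb: "?P i \<in> sets lebesgue" if "i \<in> L" for i using islands_lebesgue[OF M(1) A(1)[OF that]] .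
  have "I \<subseteq> ?U \<or> island (I - ?U)" if I: "I \<in> M" for I
  proof (cases "\<exists>i\<in>L. I \<in> A (f i)")
    case False
    have "I \<inter> ?P i = {}" if "i \<in> L" for i
      using islands_disjoint_Union[OF M(1), of "{I}" "A (f i)"] A(1)[OF that] I False that by simp
    then have "I - ?U = I" by blast
    then show ?thesis using M(1) I by (simp add: islands_def)
  qed blast
  moreover have "V j ?U \<le> real (card L) * real k" if j: "j \<in> N - L" for j
  proof -
    have "j \<in> {1..n}" using j N by auto
    then have "V j ?U = (\<Sum>i\<in>L. V j (?P i))"
      by (intro density.val_UN density finL dP leb) auto
    also have "\<dots> \<le> (\<Sum>i\<in>L. real k)" using f(5) j by (intro sum_mono) (auto intro: less_imp_le)
    finally show ?thesis by simp
  qed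
  moreover have "card L * (k - 1) \<le> whole_removed M ?U"
  proof -
    have "card L * (k - 1) = (\<Sum>i\<in>L. card (A (f i)))" using A(2) by simp
    also have "\<dots> = card (\<Union>i\<in>L. A (f i))"
      using finL A(1) M(2) dAf by (intro card_UN_disjoint[symmetric]) (auto intro: finite_subset)
    also have "\<dots> \<le> whole_removed M ?U"
      unfolding whole_removed_def using A(1) M(2) by (intro card_mono) auto
    finally show ?thesis .
  qed
  moreover have "feasible (?P i)" if "i \<in> L" for i
    using feasible_Union[OF M(1) A(1)[OF that]] A(2)[OF that] by simp
  moreover have "?P i \<subseteq> \<Union>M" if "i \<in> L" for i using A(1)[OF that] by blast
  ultimately show ?thesis
    unfolding allocation_def using f(1,4) \<open>L \<noteq> {}\<close> dP leb by simp
qed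

lemma sound_pair_found:
  assumes snd: "sound (Ranked M N Z A0 B)"
    and "j \<in> N" and "V j (\<Union>(A0 \<union> B j)) \<ge> real k" and b: "b \<in> B j"
  shows "sound (Trim M N Z ((A0 \<union> B j) - {b}) b)"
proof -
  have M: "finite M" and A0: "A0 \<subseteq> M" "card A0 < k" and B: "B j \<subseteq> M - A0" "card (B j) = k - card A0"
    and cheap: "\<And>i D. i \<in> N \<Longrightarrow> D \<subseteq> M - A0 \<Longrightarrow> card A0 + card D = k - 1 \<Longrightarrow> V i (\<Union>(A0 \<union> D)) < real k"
    using snd assms(2) by (auto simp: call_def islands_def search_def most_valuable_def)
  have fin: "finite (B j)" "finite A0" using B A0 M by (auto intro: finite_subset)
  have eq: "(A0 \<union> B j) - {b} = A0 \<union> (B j - {b})" using b B by auto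
  have c: "card A0 + card (B j - {b}) = k - 1" using B(2) b A0(2) fin by (simp add: card_Diff_singleton)
  moreover have "card (A0 \<union> (B j - {b})) = card A0 + card (B j - {b})"
    using fin B(1) by (intro card_Un_disjoint) auto
  moreover have "V i (\<Union>(A0 \<union> (B j - {b}))) < real k" if "i \<in> N" for i
    using cheap[OF that, of "B j - {b}"] B(1) c by auto
  moreover have "\<Union>(A0 \<union> (B j - {b})) \<union> b = \<Union>(A0 \<union> B j)" using b by blast
  then have "real k \<le> V j (\<Union>(A0 \<union> (B j - {b})) \<union> b)" using assms(3) by simp
  ultimately show ?thesis unfolding eq using snd assms(2) b A0 B(1) by auto
qed

text \<open>An extension of \<open>A0 - {I}\<close> either contains \<open>I\<close>, and then it extends \<open>A0\<close>, or it adds to \<open>A0 - {I}\<close> as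
  many islands outside \<open>A0\<close> as \<open>B i\<close> has; then it is worth at most as much as \<open>A0 \<union> B i\<close> to agent
  \<open>i\<close>, for whom the test of the loop has failed.\<close>

lemma sound_shrink:
  assumes snd: "sound (Ranked M N Z A0 B)"
    and small: "\<forall>j\<in>N. V j (\<Union>(A0 \<union> B j)) < real k" and I: "I \<in> A0"
  shows "search M N (A0 - {I})"
proof -
  have M: "islands M" "finite M" and N: "N \<subseteq> {1..n}" and A0: "A0 \<subseteq> M" "card A0 < k"
    and cheap: "\<And>i D. i \<in> N \<Longrightarrow> D \<subseteq> M - A0 \<Longrightarrow> card A0 + card D = k - 1 \<Longrightarrow> V i (\<Union>(A0 \<union> D)) < real k"
    and B: "\<And>j. j \<in> N \<Longrightarrow> most_valuable (V j) (k - card A0) (M - A0) (B j)"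
    using snd by (auto simp: call_def islands_def search_def)
  have fin: "finite A0" using A0 M by (auto intro: finite_subset)
  have cI: "Suc (card (A0 - {I})) = card A0" using fin I by (metis card_Suc_Diff1)
  have "V i (\<Union>((A0 - {I}) \<union> D)) < real k"
    if i: "i \<in> N" and D: "D \<subseteq> M - (A0 - {I})" and c: "card (A0 - {I}) + card D = k - 1" for i D
  proof (cases "I \<in> D")
    case True
    have finD: "finite D" using D M by (meson Diff_subset finite_subset order_trans)
    have "(A0 - {I}) \<union> D = A0 \<union> (D - {I})" using True I by blast
    moreover have "card A0 + card (D - {I}) = k - 1"
      using c cI True finD by (metis add_Suc add_Suc_right card_Suc_Diff1)
    ultimately show ?thesis using cheap[OF i, of "D - {I}"] D by auto
  next
    case False
    have D': "D \<subseteq> M - A0" using D False by blast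
    have j: "i \<in> {1..n}" using i N by auto
    have nn: "0 \<le> V i J" for J using density.val_nonneg[OF density[OF j]] .
    have BM: "B i \<subseteq> M - A0" using B[OF i] by (auto simp: most_valuable_def)
    have finB: "finite (B i)" using BM M(2) by (auto intro: finite_subset)
    have finD: "finite D" using D' M(2) by (auto intro: finite_subset)
    have "V i (\<Union>((A0 - {I}) \<union> D)) \<le> V i (\<Union>(A0 \<union> D))"
      using A0 D' by (intro density.val_mono[OF density[OF j]] islands_lebesgue[OF M(1)]) auto
    also have "\<dots> = sum (V i) (A0 \<union> D)" using A0 D' by (intro val_islands[OF M(1) _ j]) auto
    also have "\<dots> = sum (V i) A0 + sum (V i) D"
      using fin finD D' by (intro sum.union_disjoint) auto
    also have "sum (V i) D \<le> sum (V i) (B i)"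
      using D' c cI A0(2) M(2) nn by (intro most_valuable_sum_ge[OF B[OF i]]) auto
    also have "sum (V i) A0 + sum (V i) (B i) = sum (V i) (A0 \<union> B i)"
      using fin finB BM by (intro sum.union_disjoint[symmetric]) auto
    also have "\<dots> = V i (\<Union>(A0 \<union> B i))"
      using A0 BM by (intro val_islands[OF M(1) _ j, symmetric]) auto
    also have "\<dots> < real k" using small i by blast
    finally show ?thesis by simp
  qed
  moreover have "card (A0 - {I}) < k" using cI A0(2) by linarith
  ultimately show ?thesis using A0(1) by (auto simp: search_def)
qed

lemma island_prefix:
  assumes "island b"
  shows "is_interval (prefix b r \<inter> X)" and "prefix b r \<in> sets lebesgue"
    and "b \<subseteq> prefix b r \<or> island (b - prefix b r)"
proof -
  have b: "is_interval b" "bounded b" "is_interval (b \<inter> X)" using assms by (auto simp: island_def)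
  have "prefix b r \<inter> X = {x \<in> b \<inter> X. x \<le> Inf b + r}" by (auto simp: prefix_def)
  then show "is_interval (prefix b r \<inter> X)" using is_interval_Int_ray(1)[OF b(3)] by simp
  have "bounded (prefix b r)" using b(2) by (rule bounded_subset) (auto simp: prefix_def)
  then show "prefix b r \<in> sets lebesgue"
    using is_interval_Int_ray(1)[OF b(1)] by (intro bounded_interval_lebesgue) (auto simp: prefix_def)
  have d: "b - prefix b r = {x \<in> b. Inf b + r < x}"
    "(b - prefix b r) \<inter> X = {x \<in> b \<inter> X. Inf b + r < x}" by (auto simp: prefix_def)
  have "is_interval (b - prefix b r)" "is_interval ((b - prefix b r) \<inter> X)"
    by (subst d, rule is_interval_Int_ray(2), rule b)+
  moreover have "bounded (b - prefix b r)" using b(2) by (rule bounded_subset) auto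
  ultimately show "b \<subseteq> prefix b r \<or> island (b - prefix b r)" by (auto simp: island_def)
qed

text \<open>Value is monotone in the cut. So an agent \<open>j\<close> with \<open>d i \<le> d j\<close> finds the piece of \<open>i\<close> worth at most
  the value \<open>k\<close> that is attained at \<open>d j\<close>, or less than \<open>k\<close> if even the full island does not reach it.\<close>

lemma sound_trim:
  assumes snd: "sound (Trim M N Z A b)"
    and cuts: "\<forall>j\<in>N. cut_point (V j) k (\<Union>A) b (d j)"
    and i: "i \<in> N" and dmin: "\<forall>j\<in>N. d i \<le> d j" and r: "d i = ereal r"
  shows "allocation M N {i} (\<lambda>_. \<Union>A \<union> prefix b r)"
proof -
  have M: "islands M" "finite M" and N: "N \<subseteq> {1..n}" and A: "A \<subseteq> M" "card A = k - 1" and b: "b \<in> M" "b \<notin> A"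
    using snd by (auto simp: call_def islands_def)
  have ib: "island b" using M(1) b by (auto simp: islands_def)
  have finA: "finite A" using A M finite_subset by blast
  let ?P = "\<Union>A \<union> prefix b r"
  have leb: "\<Union>A \<in> sets lebesgue" "b \<in> sets lebesgue" "\<And>r. prefix b r \<in> sets lebesgue"
    using islands_lebesgue[OF M(1) A(1)] ib island_lebesgue island_prefix(2) by auto
  have pb: "prefix b r \<subseteq> b" by (auto simp: prefix_def)
  have "cut_point (V i) k (\<Union>A) b (ereal r)" using cuts i r by force
  then have "V i ?P = real k" by (auto simp: cut_point_def split: if_splits)
  moreover have "V j ?P \<le> real k" if j: "j \<in> N" for j
  proof -
    have j': "j \<in> {1..n}" using j N by auto
    have cut: "cut_point (V j) k (\<Union>A) b (d j)" using cuts j by blast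
    show ?thesis
    proof (cases "V j (\<Union>A \<union> b) < real k")
      case True
      have "V j ?P \<le> V j (\<Union>A \<union> b)"
        using pb by (intro density.val_mono[OF density[OF j']] sets.Un leb) auto
      with True show ?thesis by linarith
    next
      case False
      then obtain s where s: "d j = ereal s" "V j (\<Union>A \<union> prefix b s) = real k"
        using cut by (auto simp: cut_point_def)
      have "r \<le> s" using dmin j r s(1) by (metis ereal_less_eq(3))
      then have "V j ?P \<le> V j (\<Union>A \<union> prefix b s)"
        by (intro density.val_mono[OF density[OF j']] sets.Un leb) (auto simp: prefix_def)
      with s show ?thesis by simp
    qed
  qed
  moreover have "feasible ?P"
  proof -
    have "card (insert (prefix b r) A) \<le> k"
      using A(2) finA k_pos card_insert_le_m1[of k A "prefix b r"] by simp
    moreover have "\<forall>I\<in>insert (prefix b r) A. is_interval (I \<inter> X)"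
      using island_prefix(1)[OF ib] A(1) M(1) by (auto simp: islands_def island_def)
    moreover have "?P = \<Union>(insert (prefix b r) A)" by auto
    ultimately show ?thesis unfolding feasible_def 
      using finA by (intro exI[of _ "insert (prefix b r) A"]) simp
  qed
  moreover have "?P \<subseteq> \<Union>M" using pb A(1) b(1) by blast
  moreover have "I \<subseteq> ?P \<or> island (I - ?P)" if I: "I \<in> M" for I
  proof (cases "I \<in> A")
    case False
    then have IA: "I \<inter> \<Union>A = {}"
      using islands_disjoint_Union[OF M(1), of "{I}" A] I A(1) by simp
    show ?thesis
    proof (cases "I = b")
      case True
      have "b - ?P = b - prefix b r" using IA True by blast
      then show ?thesis using island_prefix(3)[OF ib, of r] True by auto
    next
      case False
      have "I \<inter> b = {}" using M(1) I b(1) False by (auto simp: islands_def disjoint_def)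
      then have "I - ?P = I" using IA pb by blast
      then show ?thesis using M(1) I by (simp add: islands_def)
    qed
  qed blast
  moreover have "k - 1 \<le> whole_removed M ?P"
  proof -
    have "card A \<le> card {I \<in> M. I \<subseteq> ?P}" using A(1) M(2) by (intro card_mono) auto
    then show ?thesis using A(2) by (simp add: whole_removed_def)
  qed
  ultimately show ?thesis
    unfolding allocation_def using i leb by (auto simp: disjoint_family_on_def)
qed

text \<open>Both budgets lose at most \<open>card L * k\<close> of value. In the absolute case the number of agents plus the
  number of islands drops by exactly this amount. In the relative case every island of positive value
  in the new cake is what remains of such an island in the old one.\<close>

lemma sound_recurse:
  assumes cl: "call M N Z" and al: "allocation M N L P" and U: "U = (\<Union>i\<in>L. P i)"
    and D: "dummies V M N Z D"
    and cardR: "card (remainder M U \<union> D) = card M - card L * (k - 1)"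
  shows "call (remainder M U \<union> D) (N - L) (override_on Z P L)"
proof -
  let ?R = "remainder M U" and ?Z = "override_on Z P L"
  have M: "islands M" "finite M" "disjoint M" and N: "N \<subseteq> {1..n}" and cM: "card N * (k - 1) + 1 \<le> card M"
    and rich: "\<And>j. j \<in> N \<Longrightarrow> rich M N j" and srv: "served ({1..n} - N) Z"
    and Zempty: "\<And>i. i \<notin> {1..n} - N \<Longrightarrow> Z i = {}"
    and MZ: "\<Union>M \<inter> (\<Union>i. Z i) = {}" and XMZ: "X \<subseteq> \<Union>M \<union> (\<Union>i. Z i)" and bZ: "bounded (\<Union>i. Z i)"
    using cl by (auto simp: call_def islands_def)
  have L: "L \<subseteq> N" "L \<noteq> {}" "disjoint_family_on P L"
    and P: "\<And>i. i \<in> L \<Longrightarrow> real k \<le> V i (P i)" "\<And>i. i \<in> L \<Longrightarrow> feasible (P i)"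
      "\<And>i. i \<in> L \<Longrightarrow> P i \<subseteq> \<Union>M" "\<And>i. i \<in> L \<Longrightarrow> P i \<in> sets lebesgue"
    and rest: "\<And>I. I \<in> M \<Longrightarrow> I \<subseteq> U \<or> island (I - U)"
    and cheap: "\<And>j. j \<in> N - L \<Longrightarrow> V j U \<le> real (card L) * real k"
    using al unfolding allocation_def U by simp_all
  have finN: "finite N" using N by (rule finite_subset) simp
  then have finL: "finite L" using L(1) by (rule finite_subset[rotated])
  have cN: "card N = card (N - L) + card L"
    using finN finL L(1) card_mono[OF finN L(1)] by (simp add: card_Diff_subset)
  have UM: "U \<subseteq> \<Union>M" using P(3) U by blast
  have finD: "finite D" and disD: "disjoint D"
    and unitD: "\<And>I. I \<in> D \<Longrightarrow> unit_interval I" and DMZ: "\<And>I. I \<in> D \<Longrightarrow> I \<inter> (\<Union>M \<union> (\<Union>i. Z i)) = {}"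
    and zeroD: "\<And>I j. I \<in> D \<Longrightarrow> j \<in> N \<Longrightarrow> V j I = 0"
    using D by (auto simp: dummies_def)
  have isl: "islands (?R \<union> D)"
    unfolding islands_def
  proof (intro conjI ballI)
    show "finite (?R \<union> D)" using finite_remainder[OF M(2)] finD by simp
    show "disjoint (?R \<union> D)"
    proof (rule disjoint_union)
      show "\<Union>?R \<inter> \<Union>D = {}" using DMZ by (auto simp: Union_remainder)
    qed (use disjoint_remainder[OF M(3)] disD in auto)
    fix I assume "I \<in> ?R \<union> D"
    then show "island I"
    proof
      assume "I \<in> ?R"
      then obtain J where "J \<in> M" "I = J - U" "I \<noteq> {}" by (auto simp: remainder_def)
      then show ?thesis using rest[of J] by auto
    next
      assume I: "I \<in> D"
      then have "I \<inter> X = {}" using DMZ[OF I] XMZ by blast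
      then show ?thesis
        using unitD[OF I] unit_interval_bounded[OF unitD[OF I]] by (simp add: island_def unit_interval_def)
    qed
  qed
  have leb: "\<Union>M \<in> sets lebesgue" "U \<in> sets lebesgue" "\<Union>(?R \<union> D) \<in> sets lebesgue"
    using islands_lebesgue[OF M(1)] islands_lebesgue[OF isl] finL P(4) by (auto simp: U)
  have cR: "real (card (?R \<union> D)) = real (card M) - real (card L) * (real k - 1)"
    and cR': "card (N - L) * (k - 1) + 1 \<le> card (?R \<union> D)"
  proof -
    have *: "card (N - L) * (k - 1) + card L * (k - 1) + 1 \<le> card M"
      using cM by (simp add: cN add_mult_distrib)
    then show "card (N - L) * (k - 1) + 1 \<le> card (?R \<union> D)" by (simp add: cardR)
    have "card L * (k - 1) \<le> card M" using * by simp
    then show "real (card (?R \<union> D)) = real (card M) - real (card L) * (real k - 1)"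
      using k_pos by (simp add: cardR of_nat_diff)
  qed
  have "rich (?R \<union> D) (N - L) j" if j: "j \<in> N - L" for j
  proof -
    have j': "j \<in> {1..n}" "j \<in> N" using j N by auto
    interpret density "w j" by (rule density[OF j'(1)])
    have "\<Union>M - U \<subseteq> \<Union>(?R \<union> D)" using Union_remainder[of M U] by blast
    then have "V j (\<Union>M - U) \<le> V j (\<Union>(?R \<union> D))" by (intro val_mono sets.Diff leb)
    then have ge: "V j (\<Union>M) - real (card L) * real k \<le> V j (\<Union>(?R \<union> D))"
      using cheap[OF j] val_Diff[OF leb(1,2) UM] by linarith
    from rich[OF j'(2)] show ?thesis unfolding rich_def
    proof
      assume "real (card N) + real (card M) - 1 \<le> V j (\<Union>M)"
      then have "real (card (N - L)) + real (card (?R \<union> D)) - 1 \<le> V j (\<Union>(?R \<union> D))"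
        using ge by (simp add: cR cN algebra_simps)
      then show "real (card (N - L)) + real (card (?R \<union> D)) - 1 \<le> V j (\<Union>(?R \<union> D)) \<or>
        card {I \<in> ?R \<union> D. 0 < V j I} \<le> k \<and> real k * real (card (N - L)) \<le> V j (\<Union>(?R \<union> D))" ..
    next
      assume *: "card {I \<in> M. 0 < V j I} \<le> k \<and> real k * real (card N) \<le> V j (\<Union>M)"
      have "{I \<in> ?R \<union> D. 0 < V j I} \<subseteq> (\<lambda>I. I - U) ` {I \<in> M. 0 < V j I}"
      proof
        fix I assume I: "I \<in> {I \<in> ?R \<union> D. 0 < V j I}"
        then have "I \<in> ?R" using zeroD[of I j] j'(2) by auto
        then obtain J where J: "J \<in> M" "I = J - U" by (auto simp: remainder_def)
        have "V j I \<le> V j J"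
          using J M(1) leb(2) by (intro val_mono) (auto simp: islands_def intro: island_lebesgue)
        then show "I \<in> (\<lambda>I. I - U) ` {I \<in> M. 0 < V j I}" using I J by auto
      qed
      then have "card {I \<in> ?R \<union> D. 0 < V j I} \<le> card {I \<in> M. 0 < V j I}"
        using M(2) by (intro surj_card_le) auto
      moreover have "real k * real (card (N - L)) \<le> V j (\<Union>(?R \<union> D))"
        using * ge by (simp add: cN algebra_simps)
      ultimately show "real (card (N - L)) + real (card (?R \<union> D)) - 1 \<le> V j (\<Union>(?R \<union> D)) \<or>
        card {I \<in> ?R \<union> D. 0 < V j I} \<le> k \<and> real k * real (card (N - L)) \<le> V j (\<Union>(?R \<union> D))"
        using * by linarith
    qed
  qed
  moreover have UZ: "(\<Union>i. ?Z i) = (\<Union>i. Z i) \<union> U"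
  proof -
    have "Z i = {}" if "i \<in> L" for i using Zempty that L(1) by blast
    then show ?thesis unfolding U by (fastforce simp: override_on_def split: if_splits)
  qed
  moreover have "served ({1..n} - (N - L)) ?Z"
  proof -
    have PZ: "P i \<inter> Z j = {}" if "i \<in> L" for i j using P(3)[OF that] MZ by blast
    have "?Z i \<inter> ?Z j = {}" if "i \<noteq> j" for i j
      using that PZ[of i j] PZ[of j i] L(3) srv
      by (auto simp: override_on_def disjoint_family_on_def served_def)
    then have "disjoint_family ?Z" by (auto simp: disjoint_family_on_def)
    moreover have "real k \<le> V i (?Z i) \<and> feasible (?Z i)" if "i \<in> {1..n} - (N - L)" for i
      using that P(1,2)[of i] srv by (cases "i \<in> L") (auto simp: served_def)
    ultimately show ?thesis by (simp add: served_def)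
  qed
  moreover have "?Z i = {}" if "i \<notin> {1..n} - (N - L)" for i
  proof -
    have "i \<notin> L" "i \<notin> {1..n} - N" using that L(1) N by auto
    then show ?thesis using Zempty by simp
  qed
  moreover have "\<Union>(?R \<union> D) \<inter> (S \<union> U) = {}" if "S = (\<Union>i. Z i)" for S
  proof -
    have "\<Union>D \<inter> (\<Union>M \<union> S) = {}" using DMZ that by (simp add: Union_disjoint)
    then have "\<Union>D \<inter> (S \<union> U) = {}" using UM by blast
    moreover have "(\<Union>M - U) \<inter> (S \<union> U) = {}" using MZ that by blast
    ultimately show ?thesis by (simp add: Union_remainder Int_Un_distrib2)
  qed
  moreover have "X \<subseteq> \<Union>(?R \<union> D) \<union> (S \<union> U)" if "S = (\<Union>i. Z i)" for S
  proof -
    have "X \<subseteq> \<Union>M \<union> S" using XMZ that by simp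
    then show ?thesis by (auto simp: Union_remainder)
  qed
  moreover have "bounded ((\<Union>i. Z i) \<union> U)"
  proof -
    have "bounded (\<Union>M)" using M(1) by (auto simp: islands_def island_def)
    then have "bounded U" using UM by (rule bounded_subset)
    then show ?thesis using bZ by simp
  qed
  moreover have "N - L \<subseteq> {1..n}" using N by blast
  ultimately show ?thesis using isl cR' by (simp add: call_def)
qed

lemma sound_step:
  assumes "alg_step V k s s'" and "sound s"
  shows "sound s'"
  using assms
proof (cases rule: alg_step.cases)
  case no_agent
  then show ?thesis using assms(2) by (simp add: call_def)
next
  case single_agent
  then show ?thesis using assms(2) sound_finish_single by simp
next
  case case1
  then show ?thesis using assms(2) sound_case1 by auto
next
  case (case2 N A L f M Z)
  have "allocation M N L (\<lambda>i. \<Union>(A (f i)))"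
    using assms(2) case2(1) by (intro sound_case2[OF _ case2(4,5), of _ Z]) simp
  then show ?thesis using assms(2) case2(1,2) by simp
next
  case pair_found
  then show ?thesis using assms(2) sound_pair_found by blast
next
  case shrink
  then show ?thesis using assms(2) sound_shrink by auto
next
  case (trim N A b d i r M Z)
  have "allocation M N {i} (\<lambda>_. \<Union>A \<union> prefix b r)"
    using assms(2) trim(1) by (intro sound_trim[OF _ trim(3-6), of _ Z]) simp
  then show ?thesis using assms(2) trim(1,2) by simp
next
  case (recurse U P L M N Z)
  have cl: "call M N Z" and al: "allocation M N L P" using assms(2) recurse by auto
  have M: "finite M" "disjoint M" using cl by (auto simp: call_def islands_def)
  have "card L * (k - 1) \<le> whole_removed M U" using al recurse by (auto simp: allocation_def)
  then have "card (remainder M U \<union> {}) = card M - card L * (k - 1)"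
    using card_remainder[OF M, of U] recurse(4) by simp
  then have "call (remainder M U \<union> {}) (N - L) (override_on Z P L)"
    by (intro sound_recurse[OF cl al recurse(3)]) (auto simp: dummies_def)
  then show ?thesis using recurse by simp
next
  case (recurse_with_dummies U P L M N Z D)
  then have "call (remainder M U \<union> D) (N - L) (override_on Z P L)"
    using assms(2) by (intro sound_recurse) auto
  then show ?thesis using recurse_with_dummies by simp
qed simp_all

lemma sound_reachable:
  assumes "(alg_step V k)\<^sup>*\<^sup>* s s'" and "sound s"
  shows "sound s'"
  using assms by (induction rule: rtranclp_induct) (auto intro: sound_step)

section \<open>Progress and termination\<close>

lemma val_outside:
  assumes "j \<in> {1..n}" and "I \<inter> X = {}"
  shows "V j I = 0"
proof -
  have "indicator I x *\<^sub>R w j x = 0" for x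
    using zero_outside[OF assms(1), of x] assms(2) by (auto simp: indicator_def)
  then show ?thesis unfolding val_def set_lebesgue_integral_def by (simp only: Bochner_Integration.integral_zero)
qed

lemma ex_unit_intervals_outside:
  fixes Y :: "real set"
  assumes "bounded Y"
  shows "\<exists>D. finite D \<and> card D = c \<and> disjoint D \<and> (\<forall>I\<in>D. unit_interval I \<and> I \<inter> Y = {})"
proof -
  obtain b where b: "\<And>y. y \<in> Y \<Longrightarrow> \<bar>y\<bar> \<le> b" using assms by (auto simp: bounded_real)
  define J where "J i = {b + 2 * real i + 1..b + 2 * real i + 2}" for i :: nat
  have J: "unit_interval (J i)" "J i \<inter> Y = {}" for i
    using b by (force simp: J_def unit_interval_def is_interval_cc)+
  have disj: "J i \<inter> J i' = {}" if "i < i'" for i i'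
  proof -
    have "real i + 1 \<le> real i'" using that by simp
    then show ?thesis by (auto simp: J_def)
  qed
  have disj': "J i \<inter> J i' = {}" if "i \<noteq> i'" for i i'
    using that disj[of i i'] disj[of i' i] by (cases i i' rule: linorder_cases) auto
  moreover have "J i \<noteq> {}" for i by (simp add: J_def)
  ultimately have "inj J" by (metis Int_absorb injI)
  then have "card (J ` {..<c}) = c" by (simp add: card_image inj_on_subset)
  moreover have "disjoint (J ` {..<c})"
  proof (rule disjointI)
    fix a b assume "a \<in> J ` {..<c}" "b \<in> J ` {..<c}" "a \<noteq> b"
    then obtain i i' where "a = J i" "b = J i'" "i \<noteq> i'" by blast
    then show "a \<inter> b = {}" using disj' by simp
  qed
  ultimately show ?thesis using J by (intro exI[of _ "J ` {..<c}"]) auto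
qed

text \<open>A deadlock would have to occur in one of the following ways, which the invariant excludes: too few islands to
  choose from; no envy-free matching although every set is acceptable to someone; an unsuccessful
  search with \<open>A0 = {}\<close>, when \<open>B j\<close> consists of the \<open>k\<close> best islands of \<open>j\<close>; an agent without cut point; or
  no room for dummies, for which any place outside a bounded set will do.\<close>

lemma progress:
  assumes "sound s"
  shows "(\<exists>Z. s = Finished Z) \<or> (\<exists>s'. alg_step V k s s')"
proof (cases s)
  case (Divide M N Z)
  then have "finite M" "card N * (k - 1) + 1 \<le> card M" "N \<subseteq> {1..n}"
    using assms by (auto simp: call_def islands_def)
  moreover from this have "finite N" by (auto intro: finite_subset)
  ultimately have M: "finite M" "card N * (k - 1) + 1 \<le> card M" "finite N" by auto
  consider "card N = 0" | "card N = 1" | "2 \<le> card N" by linarith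
  then show ?thesis
  proof cases
    case 1
    then have "N = {}" using M(3) by simp
    then show ?thesis using Divide alg_step.no_agent by blast
  next
    case 2
    then obtain i where i: "N = {i}" by (auto simp: card_1_singleton_iff)
    have "k \<le> card M" using M 2 by simp
    then obtain B where "most_valuable (V i) k M B" using ex_most_valuable M(1) by blast
    then have "alg_step V k (Divide M {i} Z) (Finished (Z(i := \<Union>B)))" by (rule alg_step.single_agent)
    then show ?thesis using Divide i by blast
  next
    case 3
    obtain A where "\<forall>t<card N. A t \<subseteq> M \<and> card (A t) = k - 1" "disjoint_family_on A {..<card N}"
      using ex_disjoint_selection[of M "card N" "k - 1"] M by auto
    then show ?thesis using Divide 3 alg_step.select_sets by blast
  qed
next
  case (Selected M N Z A)
  show ?thesis
  proof (cases "\<forall>t<card N. \<not> barren V k N (\<Union>(A t))")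
    case True
    have "N \<subseteq> {1..n}" "2 \<le> card N" using assms Selected by (auto simp: call_def)
    then have N: "finite N" "N \<noteq> {}" by (auto intro: finite_subset)
    have "\<exists>i\<in>N. real k \<le> V i (\<Union>(A t))" if "t \<in> {..<card N}" for t
      using True that by (auto simp: barren_def not_less)
    then obtain L f where "envy_free_matching N {..<card N} (\<lambda>i t. V i (\<Union>(A t)) \<ge> real k) L f" "L \<noteq> {}"
      using ex_envy_free_matching[of N "{..<card N}" "\<lambda>i t. V i (\<Union>(A t)) \<ge> real k"] N by auto
    with True have "alg_step V k (Selected M N Z A) (Allocate M N Z L (\<lambda>i. \<Union>(A (f i))))"
      by (rule alg_step.case2)
    then show ?thesis using Selected by blast
  next
    case False
    then obtain t where "t < card N" "barren V k N (\<Union>(A t))" by blast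
    then have "alg_step V k (Selected M N Z A) (Search M N Z (A t))" by (rule alg_step.case1)
    then show ?thesis using Selected by blast
  qed
next
  case (Search M N Z A0)
  then have A0: "A0 \<subseteq> M" "card A0 < k" and M: "finite M" "card N * (k - 1) + 1 \<le> card M" "2 \<le> card N"
    using assms by (auto simp: search_def call_def islands_def)
  have "1 * (k - 1) \<le> card N * (k - 1)" using M(3) by (intro mult_right_mono) auto
  then have "k \<le> card M" using M(2) by linarith
  moreover have "card (M - A0) = card M - card A0"
    using A0(1) M(1) by (intro card_Diff_subset) (auto intro: finite_subset)
  ultimately have "k - card A0 \<le> card (M - A0)" by simp
  then have "\<forall>j. \<exists>B. most_valuable (V j) (k - card A0) (M - A0) B"
    using ex_most_valuable M(1) by (metis finite_Diff)
  then obtain B where "\<forall>j\<in>N. most_valuable (V j) (k - card A0) (M - A0) (B j)" by metis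
  then have "alg_step V k (Search M N Z A0) (Ranked M N Z A0 B)" by (rule alg_step.rank)
  then show ?thesis using Search by blast
next
  case (Ranked M N Z A0 B)
  then have cl: "call M N Z" and A0: "card A0 < k" "A0 \<subseteq> M" and N: "2 \<le> card N" and M: "finite M"
    and B: "\<And>j. j \<in> N \<Longrightarrow> most_valuable (V j) (k - card A0) (M - A0) (B j)"
    using assms by (auto simp: search_def call_def islands_def)
  show ?thesis
  proof (cases "\<exists>j\<in>N. real k \<le> V j (\<Union>(A0 \<union> B j))")
    case True
    then obtain j where j: "j \<in> N" "real k \<le> V j (\<Union>(A0 \<union> B j))" by blast
    have "card (B j) \<noteq> 0" using B[OF j(1)] A0 by (simp add: most_valuable_def)
    then have "B j \<noteq> {}" by auto
    then obtain b where "b \<in> B j" by blast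
    with j have "alg_step V k (Ranked M N Z A0 B) (Trim M N Z ((A0 \<union> B j) - {b}) b)"
      by (rule alg_step.pair_found)
    then show ?thesis using Ranked by blast
  next
    case False
    have "N \<noteq> {}" using N by auto
    then obtain j where j: "j \<in> N" by blast
    have "A0 \<noteq> {}"
    proof
      assume "A0 = {}"
      then have "real k \<le> V j (\<Union>(A0 \<union> B j))"
        using best_islands_worth_k[OF cl j] B[OF j] by simp
      then show False using False j by blast
    qed
    then obtain I where I: "I \<in> A0" by blast
    have "\<forall>j\<in>N. V j (\<Union>(A0 \<union> B j)) < real k" using False by (simp add: not_le)
    then have "alg_step V k (Ranked M N Z A0 B) (Search M N Z (A0 - {I}))"
      using I by (rule alg_step.shrink)
    then show ?thesis using Ranked by blast
  qed
next
  case (Trim M N Z A b)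
  then have M: "islands M" and N: "N \<subseteq> {1..n}" and A: "A \<subseteq> M" and b: "b \<in> M" "b \<notin> A"
    and cheap: "\<And>j. j \<in> N \<Longrightarrow> V j (\<Union>A) < real k"
    using assms by (auto simp: call_def)
  obtain j0 where j0: "j0 \<in> N" "real k \<le> V j0 (\<Union>A \<union> b)" using Trim assms by auto
  have "\<exists>d. cut_point (V j) k (\<Union>A) b d" if j: "j \<in> N" for j
  proof (cases "V j (\<Union>A \<union> b) < real k")
    case False
    have "is_interval b" "bounded b" using M b(1) by (auto simp: islands_def island_def)
    moreover have "\<Union>A \<inter> b = {}" using islands_disjoint_Union[OF M A, of "{b}"] b by simp
    moreover have "j \<in> {1..n}" using j N by blast
    ultimately have "\<exists>r. 0 \<le> r \<and> r \<le> measure lborel b \<and> V j (\<Union>A \<union> prefix b r) = real k"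
      using False cheap[OF j] islands_lebesgue[OF M A]
      by (intro density.ex_cut density) (auto intro: less_imp_le)
    then show ?thesis using False by (auto simp: cut_point_def)
  qed (simp add: cut_point_def)
  then obtain d where d: "\<forall>j\<in>N. cut_point (V j) k (\<Union>A) b (d j)" by metis
  have finN: "finite N" using N by (rule finite_subset) simp
  then have "Min (d ` N) \<in> d ` N" using j0(1) by (intro Min_in) auto
  then obtain i where i: "i \<in> N" "d i = Min (d ` N)" by force
  then have dmin: "\<forall>j\<in>N. d i \<le> d j" using finN by simp
  obtain r0 where "d j0 = ereal r0" using d j0 by (force simp: cut_point_def)
  then have "d i \<noteq> \<infinity>" using dmin j0(1) by force
  then obtain r where "d i = ereal r" using d i(1) by (force simp: cut_point_def split: if_splits)
  with d i(1) dmin have "alg_step V k (Trim M N Z A b) (Allocate M N Z {i} (\<lambda>_. \<Union>A \<union> prefix b r))"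
    by (rule alg_step.trim)
  then show ?thesis using Trim by blast
next
  case (Allocate M N Z L P)
  then have cl: "call M N Z" and al: "allocation M N L P" using assms by auto
  have M: "finite M" "disjoint M" "islands M" and cM: "card N * (k - 1) + 1 \<le> card M" and N: "N \<subseteq> {1..n}"
    using cl by (auto simp: call_def islands_def)
  define U where "U = (\<Union>i\<in>L. P i)"
  show ?thesis
  proof (cases "whole_removed M U \<le> card L * (k - 1)")
    case True
    then show ?thesis using Allocate alg_step.recurse[OF U_def] by blast
  next
    case False
    have "bounded (\<Union>M)" using M(1,3) by (auto simp: islands_def island_def)
    then have "bounded (X \<union> (\<Union>M \<union> (\<Union>i. Z i)))" using cl bounded_X by (simp add: call_def)
    then obtain D where D: "finite D" "card D = whole_removed M U - card L * (k - 1)" "disjoint D"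
      "\<forall>I\<in>D. unit_interval I \<and> I \<inter> (X \<union> (\<Union>M \<union> (\<Union>i. Z i))) = {}"
      using ex_unit_intervals_outside by metis
    have "V j I = 0" if "I \<in> D" "j \<in> N" for I j
      using D(4) that N by (intro val_outside) auto
    moreover have "I \<inter> (\<Union>M \<union> (\<Union>i. Z i)) = {}" if "I \<in> D" for I
      using D(4)[rule_format, OF that] by (simp add: Int_Un_distrib)
    ultimately have dum: "dummies V M N Z D" using D(1,3,4) by (simp add: dummies_def)
    have "I \<notin> remainder M U" if "I \<in> D" for I
    proof
      assume "I \<in> remainder M U"
      then have "I \<subseteq> \<Union>M" by (auto simp: remainder_def)
      then have "I = {}" using D(4) that by blast
      then show False using D(4) that unit_interval_bounded(2) by blast
    qed
    then have "card (remainder M U \<union> D) = card (remainder M U) + card D"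
      using D(1) finite_remainder[OF M(1)] by (intro card_Un_disjoint) auto
    then have "card (remainder M U \<union> D) = card M - card L * (k - 1)"
      using card_remainder[OF M(1,2), of U] D(2) False by linarith
    with U_def have "alg_step V k (Allocate M N Z L P)
        (Divide (remainder M U \<union> D) (N - L) (override_on Z P L))"
      using False dum by (intro alg_step.recurse_with_dummies) auto
    then show ?thesis using Allocate by blast
  qed
qed simp

text \<open>Within one call the phases follow each other; only the search of Case 1 loops, and each round removes
  an island from \<open>A0\<close>.\<close>

fun state_rank :: "state \<Rightarrow> nat \<times> nat \<times> nat" where
  "state_rank (Divide M N Z) = (card N, 4, 0)"
| "state_rank (Selected M N Z A) = (card N, 3, 0)"
| "state_rank (Search M N Z A0) = (card N, 2, 2 * card A0 + 1)"
| "state_rank (Ranked M N Z A0 B) = (card N, 2, 2 * card A0)"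
| "state_rank (Trim M N Z A b) = (card N, 1, 0)"
| "state_rank (Allocate M N Z L P) = (card N, 0, 0)"
| "state_rank (Finished Z) = (0, 0, 0)"

lemma state_rank_decreases:
  assumes "alg_step V k s s'" and "sound s"
  shows "(state_rank s', state_rank s) \<in> less_than <*lex*> less_than <*lex*> less_than"
proof -
  have less: "card (N - L) < card N" if "call M N Z" "allocation M N L P" for M N Z L P
  proof -
    have "finite N" using that by (auto simp: call_def intro: finite_subset)
    moreover have "L \<subseteq> N" "L \<noteq> {}" using that by (auto simp: allocation_def)
    ultimately show ?thesis by (intro psubset_card_mono) auto
  qed
  show ?thesis
    using assms
  proof (cases rule: alg_step.cases)
    case (shrink N A0 B I M Z)
    then have "finite M" "A0 \<subseteq> M" using assms(2) by (auto simp: call_def islands_def search_def)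
    then have "finite A0" by (auto intro: finite_subset)
    then show ?thesis using shrink card_Diff1_less[of A0 I] by simp
  next
    case recurse
    then show ?thesis using assms(2) less by auto
  next
    case recurse_with_dummies
    then show ?thesis using assms(2) less by auto
  qed simp_all
qed

lemma no_infinite_run:
  assumes "sound (s 0)"
  shows "\<not> (\<forall>t. alg_step V k (s t) (s (Suc t)))"
proof
  assume run: "\<forall>t. alg_step V k (s t) (s (Suc t))"
  have "sound (s t)" for t
    by (induction t) (use assms run sound_step in auto)
  then have "\<exists>r. \<forall>t. (r (Suc t), r t) \<in> less_than <*lex*> less_than <*lex*> less_than"
    using run state_rank_decreases by (intro exI[of _ "\<lambda>t. state_rank (s t)"]) blast
  moreover have "wf (less_than <*lex*> less_than <*lex*> less_than)" by auto
  ultimately show False unfolding wf_iff_no_infinite_down_chain by blast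
qed

lemma always_outputs_if_call:
  assumes "call C {1..n} (\<lambda>_. {})"
  shows "always_outputs V k C n"
  unfolding always_outputs_def
proof (intro conjI allI impI)
  have snd: "sound (start C n)" using assms by (simp add: start_def)
  show "\<nexists>s. s 0 = start C n \<and> (\<forall>t::nat. alg_step V k (s t) (s (Suc t)))"
    using no_infinite_run snd by metis
  show "\<exists>Z. s = Finished Z"
    if "(alg_step V k)\<^sup>*\<^sup>* (start C n) s \<and> (\<nexists>s'. alg_step V k s s')" for s
    using that progress sound_reachable snd by blast
qed

lemma served_if_can_output:
  assumes "call C {1..n} (\<lambda>_. {})" and "can_output V k C n Y"
  shows "served {1..n} Y"
  using assms sound_reachable[of "start C n" "Finished Y"] by (simp add: can_output_def start_def)

end

section \<open>Normalized densities and the two guarantees\<close>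

abbreviation scaled :: "real set \<Rightarrow> real \<Rightarrow> (real \<Rightarrow> real) \<Rightarrow> real \<Rightarrow> real" where
  "scaled S c v \<equiv> \<lambda>x. if x \<in> S then c * v x else 0"

lemma val_scaled: "val (scaled S c v) Z = c * val v (Z \<inter> S)"
proof -
  have "indicator Z x *\<^sub>R scaled S c v x = c * (indicator (Z \<inter> S) x *\<^sub>R v x)" for x
    by (simp add: indicator_def)
  then show ?thesis unfolding val_def set_lebesgue_integral_def by simp
qed

lemma density_scaled:
  assumes "set_integrable lebesgue S v" and "\<forall>x\<in>S. 0 \<le> v x" and "0 \<le> c"
  shows "density (scaled S c v)"
proof
  have "(\<lambda>x. c * (indicator S x *\<^sub>R v x)) = scaled S c v"
    by (auto simp: indicator_def)
  then show "integrable lebesgue (scaled S c v)"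
    using assms(1) integrable_mult_right[of c lebesgue "\<lambda>x. indicator S x *\<^sub>R v x"]
    by (simp add: set_integrable_def)
qed (use assms in auto)

lemma multicake_lebesgue: "multicake m C \<Longrightarrow> F \<subseteq> C \<Longrightarrow> \<Union>F \<in> sets lebesgue"
proof (intro sets.finite_Union subsetI)
  assume C: "multicake m C" and F: "F \<subseteq> C"
  then show "finite F" by (auto simp: multicake_def intro: finite_subset)
  fix I assume "I \<in> F"
  with C F have "unit_interval I" by (auto simp: multicake_def)
  then show "I \<in> sets lebesgue"
    using unit_interval_bounded(1)[of I] bounded_interval_lebesgue by (simp add: unit_interval_def)
qed

text \<open>The original densities are assumed nonnegative and integrable on the multicake only; facts about
  \<^locale>\<open>density\<close> apply to their extension by 0.\<close>

lemma val_eq_scaled_1: "Z \<subseteq> \<Union>C \<Longrightarrow> val (scaled (\<Union>C) 1 v) Z = val v Z"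
  unfolding val_scaled by (simp add: Int_absorb2)

text \<open>If this failed, the relative normalization would divide by 0. The best islands are worth at least the
  average of all islands, up to a positive factor.\<close>

lemma best_islands_positive:
  assumes C: "multicake m C" "1 \<le> m" and v: "value_density C v" and pos: "0 < val v (\<Union>C)"
    and "1 \<le> k" and T: "is_best k C v T"
  shows "0 < val v (\<Union>T)"
proof -
  interpret density "scaled (\<Union>C) 1 v"
    using v by (intro density_scaled) (auto simp: value_density_def)
  have fin: "finite C" and best: "most_valuable (val v) (min k m) C T"
    using C T by (auto simp: multicake_def is_best_def)
  have TC: "T \<subseteq> C" using best by (simp add: most_valuable_def)
  have sum: "val v (\<Union>F) = sum (val v) F" if "F \<subseteq> C" for F
  proof -
    have "F \<subseteq> sets lebesgue" using multicake_lebesgue[OF C(1), of "{I}" for I] that by auto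
    then have "val (scaled (\<Union>C) 1 v) (\<Union>F) = sum (val (scaled (\<Union>C) 1 v)) F"
      using C(1) that fin by (intro val_Union) (auto simp: multicake_def intro: finite_subset pairwise_subset)
    also have "\<dots> = sum (val v) F" using that by (intro sum.cong val_eq_scaled_1) auto
    also have "val (scaled (\<Union>C) 1 v) (\<Union>F) = val v (\<Union>F)" using that by (intro val_eq_scaled_1) auto
    finally show ?thesis .
  qed
  have "real (min k m) * sum (val v) C \<le> real (card C) * sum (val v) T"
    by (rule most_valuable_average[OF best fin])
  moreover have "0 < real (min k m) * sum (val v) C"
    using pos sum[of C] assms(2,5) by simp
  ultimately have "0 < real (card C) * sum (val v) T" by linarith
  then show ?thesis using sum[OF TC] by (simp add: zero_less_mult_iff)
qed

theorem mainTheorem5: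
  fixes m n k :: nat
    and C C' :: "real set set"
    and v v' :: "nat \<Rightarrow> real \<Rightarrow> real"
    and T :: "nat \<Rightarrow> real set set"
    and S :: "nat set"
  assumes "m \<ge> 1" and "n \<ge> 1" and "k \<ge> 1"
    and "multicake m C"
    and "\<forall>i\<in>{1..n}. value_density C (v i)"
    and "\<forall>i\<in>{1..n}. val (v i) (\<Union>C) > 0"
    and "\<forall>i\<in>{1..n}. is_best k C (v i) (T i)"
    and "padding n k C C'"
    and "S \<subseteq> {1..n}"
    and "\<forall>i\<in>S. v' i = abs_normalization n k C (v i)"
    and "\<forall>i\<in>{1..n} - S. v' i = rel_normalization n k (T i) (v i)"
  shows "always_outputs (\<lambda>i. val (v' i)) k C' n \<and>
    (\<forall>Y Z. can_output (\<lambda>i. val (v' i)) k C' n Y \<and> Z = discard_dummies C Y \<longrightarrow>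
       k_feasible_allocation n k C Z \<and>
       (\<forall>i\<in>{1..n}. val (v' i) (Z i) \<ge> real k) \<and>
       (\<forall>i\<in>S. val (v i) (Z i) \<ge> min (1 / real n) (real k / (real m + real n - 1)) * val (v i) (\<Union>C)) \<and>
       (\<forall>i\<in>{1..n} - S. val (v i) (Z i) \<ge> 1 / real n * val (v i) (\<Union>(T i))) \<and>
       (\<forall>i\<in>{1..n}.
          (if i \<in> S
           then 1 / real n * val (v i) (\<Union>(T i))
                  \<le> min (1 / real n) (real k / (real m + real n - 1)) * val (v i) (\<Union>C)
           else min (1 / real n) (real k / (real m + real n - 1)) * val (v i) (\<Union>C)
                  \<le> 1 / real n * val (v i) (\<Union>(T i)))
          \<longrightarrow> val (v i) (Z i) \<ge>
                max (min (1 / real n) (real k / (real m + real n - 1)) * val (v i) (\<Union>C))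
                    (1 / real n * val (v i) (\<Union>(T i)))))"
proof -
  let ?X = "\<Union>C" and ?p = "padded_size n k m"
  have cC: "card C = m" and C: "finite C" "disjoint C" "\<And>I. I \<in> C \<Longrightarrow> unit_interval I"
    using assms(4) by (auto simp: multicake_def)
  have CC': "C \<subseteq> C'" and C': "multicake ?p C'"
    using assms(8) cC by (auto simp: padding_def)
  have p: "n * (k - 1) + 1 \<le> ?p"
    unfolding padded_size_def by (simp only: diff_mult_distrib2 mult_1_right max.cobounded2)
  have T: "T i \<subseteq> C" "card (T i) \<le> k" "0 < val (v i) (\<Union>(T i))" if i: "i \<in> {1..n}" for i
  proof -
    have best: "is_best k C (v i) (T i)" using assms(7) i by blast
    then show "T i \<subseteq> C" "card (T i) \<le> k" by (auto simp: is_best_def most_valuable_def)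
    show "0 < val (v i) (\<Union>(T i))"
      using assms(5,6) i by (intro best_islands_positive[OF assms(4,1) _ _ assms(3) best]) auto
  qed

  \<comment> \<open>Both normalizations scale the density on a set of islands and cut it off elsewhere.\<close>
  define R where "R i = (if i \<in> S then ?X else \<Union>(T i))" for i
  define c where "c i = (if i \<in> S then (real n + real ?p - 1) / val (v i) ?X
    else real k * real n / val (v i) (\<Union>(T i)))" for i
  have v': "v' i = scaled (R i) (c i) (v i)" if "i \<in> {1..n}" for i
    using assms(10,11) that
    by (auto simp: R_def c_def abs_normalization_def rel_normalization_def cC fun_eq_iff)
  have R: "R i \<subseteq> ?X" "R i \<in> sets lebesgue" and c: "0 < c i" if i: "i \<in> {1..n}" for i
  proof -
    show "R i \<subseteq> ?X" using T(1)[OF i] by (auto simp: R_def)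
    show "R i \<in> sets lebesgue"
      using multicake_lebesgue[OF assms(4)] T(1)[OF i] by (auto simp: R_def)
    have "0 < val (v i) ?X" using assms(6) i by blast
    then show "0 < c i"
      using T(3)[OF i] assms(2,3) p by (auto simp: c_def intro!: divide_pos_pos)
  qed
  have val': "val (v' i) Z = c i * val (v i) (Z \<inter> R i)" if "i \<in> {1..n}" for i Z
    unfolding v'[OF that] by (rule val_scaled)

  interpret division v' k n ?X
  proof (rule division.intro)
    fix i assume i: "i \<in> {1..n}"
    have "set_integrable lebesgue (R i) (v i)"
      using assms(5) i R[OF i] unfolding value_density_def by (metis set_integrable_subset)
    then show "density (v' i)"
      unfolding v'[OF i] using assms(5) i R(1)[OF i] c[OF i]
      by (intro density_scaled) (auto simp: value_density_def)
  next
    fix i x assume i: "i \<in> {1..n}" and "x \<notin> ?X"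
    then show "v' i x = 0" using R(1)[OF i] by (auto simp: v'[OF i])
  next
    show "1 \<le> k" by fact
    show "bounded ?X" using C unit_interval_bounded(1) by (intro bounded_Union) auto
  qed

  have isl: "islands C'"
    unfolding islands_def
  proof (intro conjI ballI)
    show "finite C'" "disjoint C'" using C' by (auto simp: multicake_def)
    fix I assume I: "I \<in> C'"
    have "I \<inter> ?X = (if I \<in> C then I else {})"
    proof (cases "I \<in> C")
      case False
      have "I \<inter> J = {}" if "J \<in> C" for J
        by (rule disjointD[OF \<open>disjoint C'\<close> I]) (use CC' that False in auto)
      then show ?thesis using False by auto
    qed auto
    moreover have "unit_interval I" using C' I by (simp add: multicake_def)
    ultimately show "island I"
      using unit_interval_bounded[of I] by (simp add: island_def unit_interval_def)
  qed
  have "rich C' {1..n} i" if i: "i \<in> {1..n}" for i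
  proof (cases "i \<in> S")
    case True
    have "\<Union>C' \<inter> ?X = ?X" using CC' by blast
    moreover have "val (v i) ?X \<noteq> 0" using assms(6) i by fastforce
    ultimately have "val (v' i) (\<Union>C') = real n + real ?p - 1"
      using True by (simp add: val'[OF i] R_def c_def)
    then show ?thesis using C' by (simp add: rich_def multicake_def)
  next
    case False
    have "\<Union>C' \<inter> \<Union>(T i) = \<Union>(T i)" using CC' T(1)[OF i] by blast
    then have "val (v' i) (\<Union>C') = real k * real n"
      using False T(3)[OF i] by (simp add: val'[OF i] R_def c_def)
    moreover have "{I \<in> C'. 0 < val (v' i) I} \<subseteq> T i"
    proof
      fix I assume I: "I \<in> {I \<in> C'. 0 < val (v' i) I}"
      show "I \<in> T i"
      proof (rule ccontr)
        assume "I \<notin> T i"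
        then have "I \<inter> \<Union>(T i) = {}"
          using islands_disjoint_Union[OF isl, of "{I}" "T i"] I CC' T(1)[OF i] by simp
        then have "val (v' i) I = 0" using False
          unfolding val'[OF i] by (simp add: R_def val_def set_lebesgue_integral_def)
        with I show False by simp
      qed
    qed
    then have "card {I \<in> C'. 0 < val (v' i) I} \<le> card (T i)"
      using C(1) T(1)[OF i] by (intro card_mono) (auto intro: finite_subset)
    ultimately show ?thesis using T(2)[OF i] by (simp add: rich_def)
  qed
  then have call: "call C' {1..n} (\<lambda>_. {})"
    using isl C' p CC' by (auto simp: call_def served_def multicake_def disjoint_family_on_def)

  have main: "k_feasible_allocation n k C Z \<and> (\<forall>i\<in>{1..n}. real k \<le> val (v' i) (Z i))"
    if Y: "can_output V k C' n Y" and Z: "Z = discard_dummies C Y" for Y Z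
  proof -
    have srv: "served {1..n} Y" using served_if_can_output[OF call Y] .
    have "\<exists>F. finite F \<and> card F \<le> k \<and> (\<forall>I\<in>F. is_interval I) \<and> Z i = \<Union>F" if "i \<in> {1..n}" for i
    proof -
      obtain F where F: "finite F" "card F \<le> k" "\<forall>I\<in>F. is_interval (I \<inter> ?X)" "Y i = \<Union>F"
        using srv \<open>i \<in> {1..n}\<close> unfolding served_def feasible_def by blast
      have "card ((\<lambda>I. I \<inter> ?X) ` F) \<le> k" using F(1,2) card_image_le order_trans by blast
      moreover have "Z i = \<Union>((\<lambda>I. I \<inter> ?X) ` F)" using F(4) by (auto simp: Z discard_dummies_def)
      ultimately show ?thesis using F(1,3) by (intro exI[of _ "(\<lambda>I. I \<inter> ?X) ` F"]) auto
    qed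
    moreover have "disjoint_family_on Z {1..n}"
      using srv by (auto simp: served_def disjoint_family_on_def Z discard_dummies_def)
    moreover have "real k \<le> val (v' i) (Z i)" if i: "i \<in> {1..n}" for i
    proof -
      have "Y i \<inter> R i = Z i \<inter> R i" using R(1)[OF i] by (auto simp: Z discard_dummies_def)
      then have "val (v' i) (Z i) = val (v' i) (Y i)" by (simp add: val'[OF i])
      then show ?thesis using srv i by (simp add: served_def)
    qed
    ultimately show ?thesis by (auto simp: k_feasible_allocation_def Z discard_dummies_def)
  qed

  let ?abs = "\<lambda>i. min (1 / real n) (real k / (real m + real n - 1)) * val (v i) ?X"
  let ?rel = "\<lambda>i. 1 / real n * val (v i) (\<Union>(T i))"
  \<comment> \<open>The factor of the absolute guarantee is a minimum because padding either adds no island, and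
      then the factor is \<open>k / (m + n - 1)\<close>, or makes the normalized total \<open>n * k\<close>.\<close>
  have guarantee: "(if i \<in> S then ?abs i else ?rel i) \<le> val (v i) (Z i)"
    if i: "i \<in> {1..n}" and ZX: "Z i \<subseteq> ?X" and Zleb: "Z i \<in> sets lebesgue"
      and ge: "real k \<le> val (v' i) (Z i)" for i Z
  proof (cases "i \<in> S")
    case True
    have pos: "0 < val (v i) ?X" using assms(6) i by blast
    have "real k \<le> (real n + real ?p - 1) / val (v i) ?X * val (v i) (Z i)"
      using ge ZX True by (simp add: val'[OF i] R_def c_def Int_absorb2)
    moreover have q: "0 < real n + real ?p - 1" using assms(2) p by simp
    ultimately have *: "real k / (real n + real ?p - 1) * val (v i) ?X \<le> val (v i) (Z i)"
      using pos by (simp add: field_simps)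
    have "min (1 / real n) (real k / (real m + real n - 1)) \<le> real k / (real n + real ?p - 1)"
    proof (cases "n * k - n + 1 \<le> m")
      case True
      then have "?p = m" by (simp add: padded_size_def)
      then show ?thesis by (simp add: add.commute)
    next
      case False
      then have "?p = n * k - n + 1" by (simp add: padded_size_def)
      moreover have "n \<le> n * k" using assms(3) by simp
      ultimately have "real n + real ?p - 1 = real n * real k" by (simp add: of_nat_diff)
      then have "real k / (real n + real ?p - 1) = 1 / real n" using assms(2,3) by simp
      then show ?thesis by simp
    qed
    then have "?abs i \<le> real k / (real n + real ?p - 1) * val (v i) ?X"
      using pos by (intro mult_right_mono) auto
    then show ?thesis using * True by simp
  next
    case False
    have "density (scaled ?X 1 (v i))"
      using assms(5) i by (intro density_scaled) (auto simp: value_density_def)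
    then have "val (scaled ?X 1 (v i)) (Z i \<inter> R i) \<le> val (scaled ?X 1 (v i)) (Z i)"
      using Zleb R(2)[OF i] by (intro density.val_mono) auto
    then have "val (v i) (Z i \<inter> R i) \<le> val (v i) (Z i)"
      by (simp only: val_eq_scaled_1[OF ZX] val_eq_scaled_1[OF le_infI1[OF ZX]])
    moreover have "real k \<le> real k * real n / val (v i) (\<Union>(T i)) * val (v i) (Z i \<inter> R i)"
      using ge False by (simp add: val'[OF i] c_def)
    then have "?rel i \<le> val (v i) (Z i \<inter> R i)"
      using T(3)[OF i] assms(2,3) by (simp add: field_simps)
    ultimately show ?thesis using False by simp
  qed

  have out: "k_feasible_allocation n k C Z \<and>
      (\<forall>i\<in>{1..n}. real k \<le> val (v' i) (Z i) \<and> (if i \<in> S then ?abs i else ?rel i) \<le> val (v i) (Z i))"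
    if Y: "can_output V k C' n Y" and Z: "Z = discard_dummies C Y" for Y Z
  proof -
    have feas: "k_feasible_allocation n k C Z" and ge: "\<forall>i\<in>{1..n}. real k \<le> val (v' i) (Z i)"
      using main[OF Y Z] by auto
    have "(if i \<in> S then ?abs i else ?rel i) \<le> val (v i) (Z i)" if i: "i \<in> {1..n}" for i
    proof (rule guarantee[OF i])
      show "Z i \<subseteq> ?X" using feas i by (auto simp: k_feasible_allocation_def)
      obtain F where F: "finite F" "\<forall>I\<in>F. is_interval I" "Z i = \<Union>F"
        using feas i unfolding k_feasible_allocation_def by blast
      have "I \<in> sets lebesgue" if "I \<in> F" for I
      proof (rule bounded_interval_lebesgue)
        show "bounded I"
          by (rule bounded_subset[OF bounded_X]) (use \<open>Z i \<subseteq> ?X\<close> F(3) that in blast)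
      qed (use F that in blast)
      then show "Z i \<in> sets lebesgue" unfolding F(3) using F(1) by (intro sets.finite_Union) auto
    qed (use ge i in blast)
    then show ?thesis using feas ge by blast
  qed
  show ?thesis
  proof (intro conjI allI impI; (elim conjE)?)
    show "always_outputs V k C' n" by (rule always_outputs_if_call[OF call])
  next
    fix Y Z assume YZ: "can_output V k C' n Y" "Z = discard_dummies C Y"
    note o = out[OF YZ]
    show "k_feasible_allocation n k C Z" using o by blast
    show "\<forall>i\<in>{1..n}. real k \<le> val (v' i) (Z i)" using o by blast
    have g: "(if i \<in> S then ?abs i else ?rel i) \<le> val (v i) (Z i)" if "i \<in> {1..n}" for i
      using o that by blast
    show "\<forall>i\<in>S. ?abs i \<le> val (v i) (Z i)"
    proof
      fix i assume i: "i \<in> S"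
      with g[OF subsetD[OF assms(9) i]] show "?abs i \<le> val (v i) (Z i)" by (simp only: if_True)
    qed
    show "\<forall>i\<in>{1..n} - S. ?rel i \<le> val (v i) (Z i)"
    proof
      fix i assume "i \<in> {1..n} - S"
      with g[of i] show "?rel i \<le> val (v i) (Z i)" by (simp only: Diff_iff if_False)
    qed
    show "\<forall>i\<in>{1..n}. (if i \<in> S then ?rel i \<le> ?abs i else ?abs i \<le> ?rel i)
        \<longrightarrow> max (?abs i) (?rel i) \<le> val (v i) (Z i)"
    proof (intro ballI impI)
      fix i assume *: "if i \<in> S then ?rel i \<le> ?abs i else ?abs i \<le> ?rel i"
      assume "i \<in> {1..n}"
      from g[OF this] show "max (?abs i) (?rel i) \<le> val (v i) (Z i)"
        using * by (cases "i \<in> S") (simp_all only: if_True if_False max_absorb1 max_absorb2)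
    qed
  qed
qed

end
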